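(* Let $V_*\in\mathbb{V}_k$ be a solution to the NEPv $A(P)V=V\Lambda$, let $P_*=V_*V_*^{\mathrm H}$, assume $$g=\lambda_{k+1}(A(P_* ))-\lambda_k(A(P_* ))>0,$$ and let $$h=\max_{1\le j\le k}\big[\lambda_{k+j}(A(P_* ))-\lambda_j(A(P_* ))\big],\qquad \zeta=\frac{\sqrt g}{\sqrt g+\sqrt{2h}} .$$ Let $\xi>0$ and let $\delta$ and $d$ be the quantities defined in the context (by suprema over $\mathbb{P}_\xi$). Assume that $\delta$ is sufficiently small such that the equation $$f(\eta)\equiv g\eta-d\,\eta\sqrt{1+\eta^2}-(1+\eta^2)\delta=0$$ has positive roots, and its smallest positive root, denoted by $\eta_*$, is smaller than $\zeta$. Then the perturbed NEPv $\widetilde A(\widetilde P)\widetilde V=\widetilde V\widetilde\Lambda$ has a solution $\widetilde V_*\in\mathbb{V}_{\tau_*}$, i.e. a solution $\widetilde V_*\in\mathbb{V}_k$ with $\|\sin\Theta(\mathcal R(\widetilde V_* ),\mathcal R(V_* ))\|_2\le\tau_*$, where $$\tau_*=\frac{\eta_*}{\sqrt{1+\eta_*^2}} .$$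
   Context: Let $k\ge1$ and $2k\le n$. $\|\cdot\|_2$ is the matrix 2-norm. Eigenvalues of a Hermitian $H\in\mathbb{C}^{n\times n}$ are ordered $\lambda_1(H)\le\dots\le\lambda_n(H)$. Let $\mathbb{V}_k=\{V\in\mathbb{C}^{n\times k}: V^{\mathrm H}V=I_k\}$ and $\mathbb{P}_k=\{VV^{\mathrm H}: V\in\mathbb{V}_k\}$. $\mathcal R(V)$ is the column space of $V$. For $k$-dimensional subspaces $\mathcal X,\mathcal Y$ of $\mathbb{C}^n$ with orthonormal bases given by the columns of $X,Y$, $\Theta(\mathcal X,\mathcal Y)=\mathrm{diag}(\theta_1,\dots,\theta_k)$ with $\theta_j=\arccos\sigma_j\in[0,\pi/2]$, where the $\sigma_j$ are the singular values of $X^{\mathrm H}Y$ (canonical angles). The NEPv (eigenvector-dependent nonlinear eigenvalue problem): $A(P)=A_0+A_1(P)+A_2(P)$ is a continuous Hermitian-matrix-valued function of $P\in\mathbb{P}_k$, where $A_0\in\mathbb{C}^{n\times n}$ is a constant Hermitian matrix, $A_1(P)$ is Hermitian and a homogeneous linear function of $P$, and $A_2(P)$ is Hermitian and a nonlinear function of $P$. A solution of $A(P)V=V\Lambda$ is a $V\in\mathbb{V}_k$ such that, with $P=VV^{\mathrm H}$ and $\Lambda=V^{\mathrm H}A(P)V$, one has $A(P)V=V\Lambda$ and the eigenvalues of $\Lambda$ are the $k$ smallest eigenvalues of $A(P)$ (with multiplicity). The perturbed NEPv: $\widetilde A(P)=\widetilde A_0+\widetilde A_1(P)+\widetilde A_2(P)$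 is a continuous Hermitian-matrix-valued function of $P\in\mathbb{P}_k$, with $\widetilde A_0$ a constant Hermitian matrix and $\widetilde A_1(P),\widetilde A_2(P)$ Hermitian (perturbations of $A_1,A_2$). A solution of $\widetilde A(\widetilde P)\widetilde V=\widetilde V\widetilde\Lambda$ is defined in the same way: $\widetilde V\in\mathbb{V}_k$, $\widetilde P=\widetilde V\widetilde V^{\mathrm H}$, $\widetilde\Lambda=\widetilde V^{\mathrm H}\widetilde A(\widetilde P)\widetilde V$, the eigenvalues of $\widetilde\Lambda$ being the $k$ smallest eigenvalues of $\widetilde A(\widetilde P)$. For a real number $t\ge0$ (in particular $t=\xi$ or $t=\tau_*$): $\mathbb{V}_t=\{V\in\mathbb{V}_k:\|\sin\Theta(\mathcal R(V),\mathcal R(V_* ))\|_2\le t\}$ and $\mathbb{P}_t=\{VV^{\mathrm H}:V\in\mathbb{V}_t\}$. (The subscript $k$ in $\mathbb{V}_k,\mathbb{P}_k$ always refers to the full sets above; other subscripts refer to these neighbourhoods.) For any $\xi>0$: $\delta_0=\|\widetilde A_0-A_0\|_2$; $\delta_i=\sup_{P\in\mathbb{P}_\xi}\|\widetilde A_i(P)-A_i(P)\|_2$ and $d_i=\sup_{P\in\mathbb{P}_\xi,\,P\ne P_*}\|A_i(P)-A_i(P_* )\|_2/\|P-P_*\|_2$ for $i=1,2$; $\delta=\delta_0+\delta_1+\delta_2$ and $d=d_1+d_2$.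
   Formalization: The formal theorem adds the assumption τ_* ≤ ξ; without it the claim is false, since δ and d control the perturbation only on the ξ-neighbourhood of P_*. Finiteness of the suprema defining δ and d is also stated explicitly. *)

theory Defs
  imports "HOL-Analysis.Analysis" "HOL-Computational_Algebra.Polynomial"
begin

definition ctranspose :: "complex^'m^'n \<Rightarrow> complex^'n^'m" where
  "ctranspose A = (\<chi> i j. cnj (A $ j $ i))"

definition hermitian :: "complex^'n^'n \<Rightarrow> bool" where
  "hermitian A \<longleftrightarrow> ctranspose A = A"

definition mat_norm2 :: "('a::real_normed_field)^'m^'n \<Rightarrow> real" where
  "mat_norm2 A = onorm (\<lambda>x. A *v x)"

definition charpoly :: "complex^'n^'n \<Rightarrow> complex poly" where
  "charpoly A = det (mat [:0, 1:] - map_matrix (\<lambda>c. [:c:]) A)"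

text \<open>
  The \<open>j\<close>-th smallest eigenvalue, counted with multiplicity and with \<open>j\<close> starting at 1. It is
  meaningful only for Hermitian \<open>A\<close> (whose eigenvalues are real, so that \<^const>\<open>Re\<close>
  loses nothing) and \<open>1 \<le> j \<le> CARD('n)\<close>.
\<close>
definition eigval :: "nat \<Rightarrow> complex^'n^'n \<Rightarrow> real" where
  "eigval j A = sorted_list_of_multiset (image_mset Re (proots (charpoly A))) ! (j - 1)"

definition singval :: "nat \<Rightarrow> complex^'k^'m \<Rightarrow> real" where
  "singval j M = sqrt (eigval j (ctranspose M ** M))"

definition stiefel :: "(complex^'k^'n) set" where
  "stiefel = {V. ctranspose V ** V = mat 1}"

definition proj :: "complex^'k^'n \<Rightarrow> complex^'n^'n" where
  "proj V = V ** ctranspose V"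

text \<open>
  For \<open>X\<close> and \<open>Y\<close> with orthonormal columns, \<open>can_angles X Y\<close> is the matrix \<open>\<Theta>\<close> of canonical
  angles between the column spaces of \<open>X\<close> and \<open>Y\<close>. The index type \<open>'k\<close> carries no order, so the
  diagonal positions are numbered by an arbitrary enumeration; the norm of \<open>sin \<Theta>\<close> does not
  depend on it.
\<close>
definition index_num :: "'k::finite \<Rightarrow> nat" where
  "index_num = (SOME e. bij_betw e UNIV {1..CARD('k)})"

definition can_angles :: "complex^'k^'n \<Rightarrow> complex^'k^'n \<Rightarrow> real^'k^'k" where
  "can_angles X Y =
     (\<chi> i j. if i = j then arccos (singval (index_num i) (ctranspose X ** Y)) else 0)"

definition sin_diag :: "real^'k^'k \<Rightarrow> real^'k^'k" where
  "sin_diag D = (\<chi> i j. if i = j then sin (D $ i $ i) else 0)"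

definition stiefel_nbhd :: "real \<Rightarrow> complex^'k^'n \<Rightarrow> (complex^'k^'n) set" where
  "stiefel_nbhd t W = {V \<in> stiefel. mat_norm2 (sin_diag (can_angles V W)) \<le> t}"

definition proj_nbhd :: "real \<Rightarrow> complex^'k^'n \<Rightarrow> (complex^'n^'n) set" where
  "proj_nbhd t W = proj ` stiefel_nbhd t W"

definition nepv_solution :: "(complex^'n^'n \<Rightarrow> complex^'n^'n) \<Rightarrow> complex^'k^'n \<Rightarrow> bool" where
  "nepv_solution A V \<longleftrightarrow>
     V \<in> stiefel \<and>
     (let P = proj V; L = ctranspose V ** A P ** V in
        A P ** V = V ** L \<and>
        (\<forall>j\<in>{1..CARD('k)}. eigval j L = eigval j (A P)))"

text \<open>
  The two suprema are over reals, hence meaningful only when the sets are bounded above.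
\<close>
definition pert_values ::
  "(complex^'n^'n \<Rightarrow> complex^'n^'n) \<Rightarrow> (complex^'n^'n \<Rightarrow> complex^'n^'n) \<Rightarrow>
    real \<Rightarrow> complex^'k^'n \<Rightarrow> real set" where
  "pert_values B B' \<xi> W = (\<lambda>P. mat_norm2 (B' P - B P)) ` proj_nbhd \<xi> W"

definition lip_values ::
  "(complex^'n^'n \<Rightarrow> complex^'n^'n) \<Rightarrow> real \<Rightarrow> complex^'k^'n \<Rightarrow> real set" where
  "lip_values B \<xi> W =
     (\<lambda>P. mat_norm2 (B P - B (proj W)) / mat_norm2 (P - proj W)) ` (proj_nbhd \<xi> W - {proj W})"

definition eta_fun :: "real \<Rightarrow> real \<Rightarrow> real \<Rightarrow> real \<Rightarrow> real" where
  "eta_fun g d \<delta> \<eta> = g * \<eta> - d * \<eta> * sqrt (1 + \<eta>\<^sup>2) - (1 + \<eta>\<^sup>2) * \<delta>"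

definition smallest_positive_root :: "(real \<Rightarrow> real) \<Rightarrow> real \<Rightarrow> bool" where
  "smallest_positive_root f \<eta> \<longleftrightarrow> \<eta> > 0 \<and> f \<eta> = 0 \<and> (\<forall>x>0. f x = 0 \<longrightarrow> \<eta> \<le> x)"

end

theory Submission
  imports Defs
begin

text \<open>
  Write \<open>H = A(P\<^sub>*)\<close>, \<open>\<theta>\<^sub>* = arctan \<eta>\<^sub>*\<close> and \<open>\<epsilon> = \<delta> + d \<tau>\<^sub>*\<close>. Dividing
  \<open>f(\<eta>\<^sub>*) = 0\<close> by \<open>1 + \<eta>\<^sub>*\<^sup>2\<close> gives \<open>\<epsilon> = (g / 2) sin 2\<theta>\<^sub>*\<close>, and \<open>\<eta>\<^sub>* < \<zeta> < 1\<close> gives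
  \<open>\<epsilon> < g / 2\<close>. For \<open>P\<close> in the \<open>\<tau>\<^sub>*\<close>-neighbourhood of \<open>P\<^sub>*\<close> the perturbed matrix at \<open>P\<close> is within \<open>\<epsilon>\<close>
  of \<open>H\<close>, so by Weyl's inequality its \<open>k\<close> lowest eigenvalues stay separated from the others, and
  by a \<open>sin 2\<Theta>\<close> theorem the corresponding spectral projection makes an angle \<open>\<theta>\<close> with \<open>P\<^sub>*\<close> such that
  \<open>sin 2\<theta> \<le> 2\<epsilon> / g = sin 2\<theta>\<^sub>*\<close> and \<open>\<theta> < \<pi> / 4\<close>; hence \<open>\<theta> \<le> \<theta>\<^sub>*\<close>. So the map sending \<open>P\<close> to this
  projection preserves the neighbourhood. The neighbourhood consists of the graphs \<open>\<R>(V\<^sub>* + Z)\<close> with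
  \<open>V\<^sub>*\<^sup>H Z = 0\<close> and \<open>\<parallel>Z\<parallel>\<^sub>2 \<le> \<eta>\<^sub>*\<close>, a compact convex set of matrices \<open>Z\<close>, and Brouwer's theorem
  gives a fixed point, which solves the perturbed problem. The \<open>sin 2\<Theta>\<close> bound also yields the
  continuity of the spectral projection.
\<close>

section \<open>Hermitian matrices: eigenbases and characteristic polynomials\<close>

text \<open>Gaussian elimination, one equation at a time. This is the dimension count behind every
  min-max argument below. Arbitrary finite index sets are allowed because rows and columns are
  indexed sometimes by numbers, sometimes by a finite type or its \<open>option\<close>
  extension.\<close>

lemma underdetermined_system:
  fixes c :: "'i \<Rightarrow> 'j \<Rightarrow> 'a::field"
  assumes "finite I" "finite J" "card I < card J"
  shows "\<exists>a. (\<exists>j\<in>J. a j \<noteq> 0) \<and> (\<forall>i\<in>I. (\<Sum>j\<in>J. c i j * a j) = 0)"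
  using assms
proof (induction I arbitrary: J c rule: finite_induct)
  case empty
  then obtain j where "j \<in> J" by fastforce
  then show ?case by (intro exI[of _ "\<lambda>_. 1"]) auto
next
  case (insert i I)
  show ?case
  proof (cases "\<forall>j\<in>J. c i j = 0")
    case True
    have "card I < card J" using insert by simp
    from insert.IH[OF insert.prems(1) this, of c] obtain a
      where "\<exists>j\<in>J. a j \<noteq> 0" "\<forall>i\<in>I. (\<Sum>j\<in>J. c i j * a j) = 0" by blast
    with True show ?thesis by (intro exI[of _ a]) auto
  next
    case False
    then obtain j0 where j0: "j0 \<in> J" "c i j0 \<noteq> 0" by blast
    \<comment> \<open>Row \<open>i\<close> is used to eliminate the unknown \<open>j0\<close> from
      every other row.\<close>
    define c' where "c' r j = c r j - c r j0 * c i j / c i j0" for r j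
    have fin: "finite (J - {j0})" and less: "card I < card (J - {j0})"
      using insert j0 by auto
    obtain a where a: "\<exists>j\<in>J - {j0}. a j \<noteq> 0"
        and a0: "\<forall>r\<in>I. (\<Sum>j\<in>J - {j0}. c' r j * a j) = 0"
      using insert.IH[OF fin less, of c'] by blast
    \<comment> \<open>Back substitution: the value of the unknown \<open>j0\<close> that satisfies
      equation \<open>i\<close>.\<close>
    define t where "t = - (\<Sum>j\<in>J - {j0}. c i j * a j) / c i j0"
    define b where "b = a(j0 := t)"
    have sum_b: "(\<Sum>j\<in>J. c r j * b j) = c r j0 * t + (\<Sum>j\<in>J - {j0}. c r j * a j)" for r
      using j0 insert.prems by (subst sum.remove[of J j0]) (auto simp: b_def intro!: sum.cong)
    have "(\<Sum>j\<in>J. c r j * b j) = 0" if "r \<in> I" for r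
    proof -
      have "(\<Sum>j\<in>J - {j0}. c' r j * a j)
          = (\<Sum>j\<in>J - {j0}. c r j * a j) - c r j0 / c i j0 * (\<Sum>j\<in>J - {j0}. c i j * a j)"
        by (simp add: c'_def algebra_simps sum_subtractf sum_distrib_left)
      then show ?thesis using a0 that by (simp add: sum_b t_def)
    qed
    moreover have "(\<Sum>j\<in>J. c i j * b j) = 0"
      using j0 by (simp add: sum_b t_def)
    moreover have "\<exists>j\<in>J. b j \<noteq> 0"
      using a by (auto simp: b_def)
    ultimately show ?thesis by blast
  qed
qed

section \<open>Complex matrix algebra and the Hermitian inner product\<close>

lemma inner_complex_vec: "x \<bullet> y = Re (\<Sum>i\<in>UNIV. cnj (x $ i) * y $ i)" for x y :: "complex^'n"
  by (simp add: inner_vec_def inner_complex_def)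

lemma ctranspose_nth [simp]: "ctranspose A $ i $ j = cnj (A $ j $ i)"
  by (simp add: ctranspose_def)

lemma ctranspose_ctranspose [simp]: "ctranspose (ctranspose A) = A"
  by (simp add: vec_eq_iff)

lemma ctranspose_mult: "ctranspose (A ** B) = ctranspose B ** ctranspose A"
  by (simp add: vec_eq_iff matrix_matrix_mult_def mult.commute)

lemma ctranspose_add: "ctranspose (A + B) = ctranspose A + ctranspose B"
  by (simp add: vec_eq_iff)

lemma matrix_mult_add_left: "(A + B) ** C = A ** C + B ** C" for A B :: "'a::semiring_1^'m^'n"
  by (simp add: vec_eq_iff matrix_matrix_mult_def algebra_simps sum.distrib)

lemma matrix_mult_diff_left: "(A - B) ** C = A ** C - B ** C" for A B :: "'a::ring_1^'m^'n"
  by (simp add: vec_eq_iff matrix_matrix_mult_def algebra_simps sum_subtractf)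

lemma matrix_mult_diff_right: "A ** (B - C) = A ** B - A ** C" for A :: "'a::ring_1^'m^'n"
  by (simp add: vec_eq_iff matrix_matrix_mult_def algebra_simps sum_subtractf)

lemma ctranspose_0 [simp]: "ctranspose 0 = 0"
  by (simp add: vec_eq_iff)

lemma inner_mult_left: "(A *v x) \<bullet> y = x \<bullet> (ctranspose A *v y)"
proof -
  have "(\<Sum>i\<in>UNIV. cnj (\<Sum>j\<in>UNIV. A $ i $ j * x $ j) * y $ i)
      = (\<Sum>i\<in>UNIV. \<Sum>j\<in>UNIV. cnj (x $ j) * (cnj (A $ i $ j) * y $ i))"
    by (simp add: sum_distrib_left sum_distrib_right ac_simps)
  also have "\<dots> = (\<Sum>j\<in>UNIV. \<Sum>i\<in>UNIV. cnj (x $ j) * (cnj (A $ i $ j) * y $ i))"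
    by (rule sum.swap)
  finally show ?thesis
    by (simp add: inner_complex_vec matrix_vector_mult_def sum_distrib_left)
qed

lemma inner_mult_right: "x \<bullet> (A *v y) = (ctranspose A *v x) \<bullet> y"
  by (simp add: inner_mult_left)

lemma hermitian_inner: "hermitian H \<Longrightarrow> (H *v x) \<bullet> y = x \<bullet> (H *v y)"
  by (simp add: inner_mult_left hermitian_def)

lemma hermitian_add: "hermitian A \<Longrightarrow> hermitian B \<Longrightarrow> hermitian (A + B)"
  by (simp add: hermitian_def ctranspose_add)

lemma hermitian_gram: "hermitian (ctranspose A ** A)"
  by (simp add: hermitian_def ctranspose_mult)

lemma hermitian_congruence: "hermitian H \<Longrightarrow> hermitian (ctranspose A ** H ** A)"
  by (simp add: hermitian_def ctranspose_mult matrix_mul_assoc)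

lemma norm_sq_inner: "(norm x)\<^sup>2 = x \<bullet> x" for x :: "'a::real_inner"
  by (rule power2_norm_eq_inner)

lemma mult_scaleR: "A *v (r *\<^sub>R x) = r *\<^sub>R (A *v x)" for A :: "complex^'n^'m"
  by (rule linear_scale) simp

text \<open>The complex inner product, conjugate-linear in the first argument. The real inner
  product \<open>\<bullet>\<close> is its real part and suffices for quadratic forms; orthogonality
  over the complex numbers needs the full value.\<close>

definition cinner :: "complex^'n \<Rightarrow> complex^'n \<Rightarrow> complex" where
  "cinner x y = (\<Sum>i\<in>UNIV. cnj (x $ i) * y $ i)"

lemma cinner_add_right: "cinner x (y + z) = cinner x y + cinner x z"
  by (simp add: cinner_def algebra_simps sum.distrib)

lemma cinner_diff_right: "cinner x (y - z) = cinner x y - cinner x z"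
  by (simp add: cinner_def algebra_simps sum_subtractf)

lemma cinner_scale_right: "cinner x (c *s y) = c * cinner x y"
  by (simp add: cinner_def algebra_simps sum_distrib_left)

lemma cinner_scaleR_right: "cinner x (r *\<^sub>R y) = of_real r * cinner x y"
  by (simp add: cinner_def sum_distrib_left scaleR_conv_of_real[where 'a=complex] ac_simps)

lemma cinner_0_right [simp]: "cinner x 0 = 0"
  by (simp add: cinner_def)

lemma cinner_sum_right: "cinner x (\<Sum>j\<in>J. f j) = (\<Sum>j\<in>J. cinner x (f j))"
  by (induction J rule: infinite_finite_induct) (simp_all add: cinner_add_right)

lemma cnj_cinner: "cnj (cinner x y) = cinner y x"
  by (simp add: cinner_def mult.commute)

lemma cinner_self: "cinner x x = of_real ((norm x)\<^sup>2)"
proof -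
  have "Re (cinner x x) = (norm x)\<^sup>2"
    by (simp add: cinner_def norm_sq_inner inner_complex_vec)
  moreover have "Im (cinner x x) = 0"
    by (metis cnj_cinner complex_cnj_cancel_iff complex_eq_iff cnj.sel(2) equal_neg_zero)
  ultimately show ?thesis by (simp add: complex_eq_iff)
qed

lemma Re_cinner: "Re (cinner x y) = x \<bullet> y"
  by (simp add: cinner_def inner_complex_vec)

lemma cinner_mult_right: "cinner x (A *v y) = cinner (ctranspose A *v x) y"
proof -
  have "(\<Sum>i\<in>UNIV. cnj (\<Sum>j\<in>UNIV. cnj (A $ j $ i) * x $ j) * y $ i)
      = (\<Sum>i\<in>UNIV. \<Sum>j\<in>UNIV. cnj (x $ j) * (A $ j $ i * y $ i))"
    by (simp add: sum_distrib_left sum_distrib_right ac_simps)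
  also have "\<dots> = (\<Sum>j\<in>UNIV. \<Sum>i\<in>UNIV. cnj (x $ j) * (A $ j $ i * y $ i))"
    by (rule sum.swap)
  finally show ?thesis
    by (simp add: cinner_def matrix_vector_mult_def sum_distrib_left)
qed

lemma cinner_hermitian_eigvec:
  assumes "hermitian H" "H *v u = l *\<^sub>R u"
  shows "cinner u (H *v x) = of_real l * cinner u x"
proof -
  have "cinner u (H *v x) = cinner (l *\<^sub>R u) x"
    using assms by (simp add: cinner_mult_right hermitian_def)
  also have "\<dots> = cnj (cinner x (l *\<^sub>R u))"
    by (simp add: cnj_cinner)
  also have "\<dots> = of_real l * cinner u x"
    by (simp add: cinner_scaleR_right cnj_cinner)
  finally show ?thesis .
qed

text \<open>The orthogonal complement of a set of eigenvectors is invariant under \<open>H\<close>,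
  so a minimizer of the Rayleigh quotient on its unit sphere, which exists by compactness, is again
  an eigenvector.\<close>

lemma hermitian_min_eigvec:
  fixes H :: "complex^'n^'n"
  assumes H: "hermitian H"
    and eig: "\<And>v. v \<in> S \<Longrightarrow> \<exists>l. H *v v = l *\<^sub>R v"
    and ne: "x0 \<noteq> 0" "\<And>v. v \<in> S \<Longrightarrow> cinner v x0 = 0"
  obtains x l where "norm x = 1" "\<forall>v\<in>S. cinner v x = 0" "H *v x = l *\<^sub>R x"
    "\<forall>y. (\<forall>v\<in>S. cinner v y = 0) \<longrightarrow> l * (norm y)\<^sup>2 \<le> y \<bullet> (H *v y)"
proof -
  define K where "K = sphere 0 1 \<inter> (\<Inter>v\<in>S. {y. cinner v y = 0})"
  have closed: "closed {y. cinner v y = 0}" for v :: "complex^'n"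
    unfolding cinner_def by (intro closed_Collect_eq continuous_intros)
  have "compact K"
    unfolding K_def by (intro compact_Int_closed closed_INT ballI closed) auto
  moreover have "x0 /\<^sub>R norm x0 \<in> K"
    using ne by (auto simp: K_def cinner_scaleR_right)
  moreover have "continuous_on K (\<lambda>x. x \<bullet> (H *v x))"
    by (intro continuous_intros matrix_vector_mul_bounded_linear[THEN bounded_linear.continuous_on])
  ultimately obtain x where x: "x \<in> K" "\<And>y. y \<in> K \<Longrightarrow> x \<bullet> (H *v x) \<le> y \<bullet> (H *v y)"
    using continuous_attains_inf[of K "\<lambda>x. x \<bullet> (H *v x)"] by auto
  define l where "l = x \<bullet> (H *v x)"
  have min: "l * (norm y)\<^sup>2 \<le> y \<bullet> (H *v y)" if y: "\<And>v. v \<in> S \<Longrightarrow> cinner v y = 0" for y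
  proof (cases "y = 0")
    case False
    then have "y /\<^sub>R norm y \<in> K" using y by (auto simp: K_def cinner_scaleR_right)
    from x(2)[OF this] have "l \<le> (y \<bullet> (H *v y)) / (norm y)\<^sup>2"
      by (simp add: l_def mult_scaleR power2_eq_square divide_inverse ac_simps)
    then show ?thesis using False by (simp add: field_simps)
  qed simp
  have x_unit: "norm x = 1" and x_orth: "\<And>v. v \<in> S \<Longrightarrow> cinner v x = 0"
    using x(1) by (auto simp: K_def)
  define r where "r = H *v x - l *\<^sub>R x"
  have r_orth: "cinner v r = 0" if v: "v \<in> S" for v
  proof -
    obtain m where "H *v v = m *\<^sub>R v" using eig[OF v] by blast
    from cinner_hermitian_eigvec[OF H this, of x] show ?thesis
      using x_orth[OF v] by (simp add: r_def cinner_diff_right cinner_scaleR_right)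
  qed
  define M where "M = r \<bullet> (H *v r) - l * (norm r)\<^sup>2"
  \<comment> \<open>the first variation of the Rayleigh quotient at the minimizer, in direction \<open>- r\<close>\<close>
  have var: "0 \<le> t\<^sup>2 * M - 2 * t * (norm r)\<^sup>2" for t
  proof -
    have "l * (norm (x - t *\<^sub>R r))\<^sup>2 \<le> (x - t *\<^sub>R r) \<bullet> (H *v (x - t *\<^sub>R r))"
      by (intro min) (simp add: x_orth r_orth cinner_diff_right cinner_scaleR_right)
    moreover have "(x - t *\<^sub>R r) \<bullet> (H *v (x - t *\<^sub>R r))
        = l - 2 * t * (r \<bullet> (H *v x)) + t\<^sup>2 * (r \<bullet> (H *v r))"
      using hermitian_inner[OF H, of r x] by (simp add: l_def algebra_simps inner_commute
          matrix_vector_mult_diff_distrib mult_scaleR power2_eq_square)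
    moreover have "(norm (x - t *\<^sub>R r))\<^sup>2 = 1 - 2 * t * (r \<bullet> x) + t\<^sup>2 * (norm r)\<^sup>2"
    proof -
      have "x \<bullet> x = 1" using x_unit by (simp add: norm_sq_inner[symmetric])
      then show ?thesis
        unfolding norm_sq_inner
        by (simp add: algebra_simps inner_commute) (simp add: power2_eq_square)
    qed
    moreover have "r \<bullet> (H *v x) - l * (r \<bullet> x) = (norm r)\<^sup>2"
      by (simp add: norm_sq_inner) (simp add: r_def inner_diff_left inner_diff_right)
    ultimately have "t\<^sup>2 * (l * (norm r)\<^sup>2) + 2 * t * (r \<bullet> (H *v x) - l * (r \<bullet> x)) \<le> t\<^sup>2 * (r \<bullet> (H *v r))"
      by (simp add: algebra_simps)
    also note \<open>r \<bullet> (H *v x) - l * (r \<bullet> x) = (norm r)\<^sup>2\<close>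
    finally show ?thesis
      by (simp add: M_def algebra_simps)
  qed
  have "r = 0"
  proof (rule ccontr)
    assume "r \<noteq> 0"
    then have p: "(norm r)\<^sup>2 > 0" by simp
    \<comment> \<open>This step length makes \<open>t * M\<close> at most
      \<open>(norm r)\<^sup>2\<close>, so the quadratic term cannot offset the linear decrease
      \<open>2 * t * (norm r)\<^sup>2\<close>.\<close>
    define t where "t = (norm r)\<^sup>2 / (\<bar>M\<bar> + 1)"
    have t: "t > 0" using p by (simp add: t_def)
    have "t * M \<le> t * (\<bar>M\<bar> + 1)" using t by (intro mult_left_mono) auto
    also have "\<dots> = (norm r)\<^sup>2" by (simp add: t_def)
    finally have "t * (t * M) \<le> t * (norm r)\<^sup>2" using t by (intro mult_left_mono) auto
    then have "t * (norm r)\<^sup>2 \<le> 0" using var[of t] by (simp add: power2_eq_square algebra_simps)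
    then show False using mult_pos_pos[OF t p] by linarith
  qed
  then have "H *v x = l *\<^sub>R x" by (simp add: r_def)
  then show ?thesis using x_unit x_orth min by (intro that[of x l]) auto
qed

text \<open>Each new eigenvector minimizes the Rayleigh quotient on the complement of the earlier
  ones. The third conjunct keeps this minimality: it orders the eigenvalues and later gives lower
  bounds on complements.\<close>

lemma hermitian_eigenbasis_partial:
  fixes H :: "complex^'n^'n"
  assumes H: "hermitian H" and "m \<le> CARD('n)"
  shows "\<exists>u l. (\<forall>i<m. \<forall>j<m. cinner (u i) (u j) = (if i = j then 1 else 0)) \<and>
     (\<forall>i<m. H *v u i = l i *\<^sub>R u i) \<and>
     (\<forall>i<m. \<forall>x. (\<forall>j<i. cinner (u j) x = 0) \<longrightarrow> l i * (norm x)\<^sup>2 \<le> x \<bullet> (H *v x))"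
  using assms(2)
proof (induction m)
  case 0
  show ?case by simp
next
  case (Suc m)
  then obtain u :: "nat \<Rightarrow> complex^'n" and l where
      on: "\<forall>i<m. \<forall>j<m. cinner (u i) (u j) = (if i = j then 1 else 0)"
    and ev: "\<forall>i<m. H *v u i = l i *\<^sub>R u i"
    and mn: "\<forall>i<m. \<forall>x. (\<forall>j<i. cinner (u j) x = 0) \<longrightarrow> l i * (norm x)\<^sup>2 \<le> x \<bullet> (H *v x)"
    by auto
  \<comment> \<open>Fewer than n eigenvectors have a nonzero common orthogonal vector.\<close>
  have "card {..<m} < card (UNIV :: 'n set)" using Suc.prems by simp
  from underdetermined_system[OF _ _ this, of "\<lambda>i j. cnj (u i $ j)"] obtain a
    where a: "\<exists>j. a j \<noteq> 0" "\<forall>i<m. (\<Sum>j\<in>UNIV. cnj (u i $ j) * a j) = 0" by auto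
  define x0 :: "complex^'n" where "x0 = (\<chi> j. a j)"
  have "x0 \<noteq> 0" using a by (auto simp: x0_def vec_eq_iff)
  moreover have "cinner v x0 = 0" if "v \<in> u ` {..<m}" for v
    using a that by (auto simp: x0_def cinner_def)
  moreover have "\<exists>l. H *v v = l *\<^sub>R v" if "v \<in> u ` {..<m}" for v
    using ev that by blast
  ultimately obtain x lx where x: "norm x = 1" "\<forall>v\<in>u ` {..<m}. cinner v x = 0"
      "H *v x = lx *\<^sub>R x"
      "\<forall>y. (\<forall>v\<in>u ` {..<m}. cinner v y = 0) \<longrightarrow> lx * (norm y)\<^sup>2 \<le> y \<bullet> (H *v y)"
    using hermitian_min_eigvec[OF H, of "u ` {..<m}" x0] by blast
  have "cinner x x = 1" by (simp add: cinner_self x)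
  moreover have "cinner x (u i) = 0" if "i < m" for i
    using x(2) that by (metis cnj_cinner complex_cnj_zero image_eqI lessThan_iff)
  ultimately show ?case
    using on ev mn x
    by (intro exI[of _ "u(m := x)"] exI[of _ "l(m := lx)"]) (auto simp: less_Suc_eq)
qed

text \<open>The values \<open>l\<close> increase because \<open>u j\<close> is orthogonal to all
  \<open>u\<close> before \<open>i \<le> j\<close> and so competes in the minimum that defines
  \<open>l i\<close>.\<close>

lemma hermitian_eigenbasis:
  fixes H :: "complex^'n^'n"
  assumes H: "hermitian H"
  obtains u l where
    "\<And>i j. i < CARD('n) \<Longrightarrow> j < CARD('n) \<Longrightarrow> cinner (u i) (u j) = (if i = j then 1 else 0)"
    "\<And>i. i < CARD('n) \<Longrightarrow> H *v u i = l i *\<^sub>R u i"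
    "\<And>i x. i < CARD('n) \<Longrightarrow> (\<And>j. j < i \<Longrightarrow> cinner (u j) x = 0) \<Longrightarrow> l i * (norm x)\<^sup>2 \<le> x \<bullet> (H *v x)"
    "\<And>i j. i \<le> j \<Longrightarrow> j < CARD('n) \<Longrightarrow> l i \<le> l j"
proof -
  from hermitian_eigenbasis_partial[OF H, of "CARD('n)"]
  obtain u :: "nat \<Rightarrow> complex^'n" and l where
      on: "\<forall>i<CARD('n). \<forall>j<CARD('n). cinner (u i) (u j) = (if i = j then 1 else 0)"
    and ev: "\<forall>i<CARD('n). H *v u i = l i *\<^sub>R u i"
    and mn: "\<forall>i<CARD('n). \<forall>x. (\<forall>j<i. cinner (u j) x = 0) \<longrightarrow> l i * (norm x)\<^sup>2 \<le> x \<bullet> (H *v x)"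
    by auto
  have "l i \<le> l j" if "i \<le> j" "j < CARD('n)" for i j
  proof -
    have "u j \<bullet> u j = 1" using on that by (simp flip: Re_cinner)
    moreover have "l i * (norm (u j))\<^sup>2 \<le> u j \<bullet> (H *v u j)"
      using mn on that by auto
    ultimately show ?thesis using ev that by (simp add: norm_sq_inner)
  qed
  then show ?thesis using on ev mn by (intro that[of u l]) auto
qed

text \<open>Similarity is carried over to matrices of polynomials by embedding constants. The
  determinant of the embedded \<open>U\<close> divides 1, hence is nonzero and can be cancelled in
  the integral domain of polynomials.\<close>

lemma charpoly_similar_diagonal:
  fixes H U D :: "complex^'n^'n"
  assumes HU: "H ** U = U ** D" and U: "invertible U"
    and D: "\<And>i j. D $ i $ j = (if i = j then c i else 0)"
  shows "charpoly H = (\<Prod>i\<in>UNIV. [:- c i, 1:])"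
proof -
  define C :: "complex^'n^'n \<Rightarrow> complex poly^'n^'n" where "C = map_matrix (\<lambda>c. [:c:])"
  have C_mult: "C (A ** B) = C A ** C B" for A B
  proof -
    have "(\<Sum>k\<in>UNIV. [:A $ i $ k * B $ k $ j:]) = [:\<Sum>k\<in>UNIV. A $ i $ k * B $ k $ j:]" for i j
      by (induction "UNIV :: 'n set" rule: infinite_finite_induct)
        (auto simp: coeff_sum poly_eq_iff coeff_pCons split: nat.splits)
    then show ?thesis
      by (simp add: C_def vec_eq_iff matrix_matrix_mult_def mult.commute)
  qed
  have X_comm: "mat [:0, 1:] ** C A = C A ** mat [:0, 1:]" for A
    by (simp add: vec_eq_iff matrix_matrix_mult_def mat_def if_distrib if_distribR cong: if_cong)
  have C1: "C (mat 1) = mat 1"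
    by (simp add: C_def vec_eq_iff mat_def one_pCons)
  have "(mat [:0, 1:] - C H) ** C U = C U ** (mat [:0, 1:] - C D)"
    by (simp add: matrix_mult_diff_left matrix_mult_diff_right X_comm HU flip: C_mult)
  then have "charpoly H * det (C U) = det (C U) * charpoly D"
    by (simp add: charpoly_def flip: C_def det_mul)
  moreover obtain U' where "U ** U' = mat 1" using U by (auto simp: invertible_def)
  then have "det (C U) * det (C U') = 1" by (simp flip: det_mul C_mult add: C1)
  then have "det (C U) \<noteq> 0" by auto
  ultimately have "charpoly H = charpoly D" by simp
  also have "\<dots> = (\<Prod>i\<in>UNIV. (mat [:0, 1:] - C D) $ i $ i)"
    unfolding charpoly_def C_def by (rule det_diagonal) (simp add: mat_def D)
  also have "\<dots> = (\<Prod>i\<in>UNIV. [:- c i, 1:])"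
    by (simp add: C_def mat_def D)
  finally show ?thesis .
qed

text \<open>The enumeration \<open>e\<close> numbers the unordered index type. Since
  \<open>l\<close> is increasing, the list of its values is already sorted and therefore equals the
  sorted list of roots in \<open>eigval\<close>. Positions count from 0, \<open>eigval\<close> from
  1.\<close>

lemma eigval_similar_diagonal:
  fixes H U D :: "complex^'n^'n"
  assumes HU: "H ** U = U ** D" and U: "invertible U"
    and D: "\<And>i j. D $ i $ j = (if i = j then complex_of_real (l (e i)) else 0)"
    and e: "bij_betw e UNIV {..<CARD('n)}"
    and mono: "\<And>i j. i \<le> j \<Longrightarrow> j < CARD('n) \<Longrightarrow> l i \<le> l j"
    and j: "j < CARD('n)"
  shows "eigval (Suc j) H = l j"
proof -
  have "proots (charpoly H) = (\<Sum>i\<in>UNIV. {#complex_of_real (l (e i))#})"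
    by (subst charpoly_similar_diagonal[OF HU U D]) (simp_all add: proots_prod)
  also have "\<dots> = (\<Sum>i\<in>{..<CARD('n)}. {#complex_of_real (l i)#})"
    by (rule sum.reindex_bij_betw[OF e])
  also have "\<dots> = image_mset (\<lambda>i. complex_of_real (l i)) (mset_set {..<CARD('n)})"
    by (simp add: sum_unfold_sum_mset)
  finally have "image_mset Re (proots (charpoly H)) = mset (map l [0..<CARD('n)])"
    by (simp add: lessThan_atLeast0 image_mset.compositionality comp_def)
  moreover have "sorted (map l [0..<CARD('n)])"
    using mono by (simp add: sorted_iff_nth_mono)
  ultimately have "sorted_list_of_multiset (image_mset Re (proots (charpoly H))) = map l [0..<CARD('n)]"
    by (simp only: sorted_list_of_multiset_mset sorted_sort_id)
  then have "eigval (Suc j) H = map l [0..<CARD('n)] ! j"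
    by (simp only: eigval_def diff_Suc_1)
  then show ?thesis using j by simp
qed

section \<open>Spectral splittings of Hermitian matrices\<close>

lemma cinner_scale_left: "cinner (c *s x) y = cnj c * cinner x y"
  by (simp add: cinner_def sum_distrib_left ac_simps)

lemma cinner_add_left: "cinner (x + y) z = cinner x z + cinner y z"
  by (simp add: cinner_def algebra_simps sum.distrib)

lemma cinner_0_left [simp]: "cinner 0 x = 0"
  by (simp add: cinner_def)

lemma cinner_sum_left: "cinner (\<Sum>j\<in>J. f j) x = (\<Sum>j\<in>J. cinner (f j) x)"
  by (induction J rule: infinite_finite_induct) (simp_all add: cinner_add_left)

lemma norm_scale: "norm (c *s x) = cmod c * norm x" for x :: "complex^'n"
  by (simp add: norm_vec_def norm_mult L2_set_right_distrib)

definition cols :: "('k \<Rightarrow> complex^'n) \<Rightarrow> complex^'k^'n" where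
  "cols v = (\<chi> i j. v j $ i)"

lemma mult_cols: "A ** cols v = cols (\<lambda>j. A *v v j)"
  by (simp add: cols_def vec_eq_iff matrix_matrix_mult_def matrix_vector_mult_def)

lemma ctranspose_cols_mult_vec: "ctranspose (cols v) *v x = (\<chi> i. cinner (v i) x)"
  by (simp add: cols_def vec_eq_iff matrix_vector_mult_def cinner_def)

lemma ctranspose_cols_mult_cols: "ctranspose (cols v) ** cols w = (\<chi> i j. cinner (v i) (w j))"
  by (simp add: cols_def vec_eq_iff matrix_matrix_mult_def cinner_def)

lemma stiefel_iff: "W \<in> stiefel \<longleftrightarrow> ctranspose W ** W = mat 1"
  by (simp add: stiefel_def)

lemma stiefel_inner: "W \<in> stiefel \<Longrightarrow> (W *v u) \<bullet> (W *v v) = u \<bullet> v"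
  by (simp add: inner_mult_left matrix_vector_mul_assoc stiefel_iff)

lemma stiefel_norm: "W \<in> stiefel \<Longrightarrow> norm (W *v u) = norm u"
  by (simp add: norm_eq_sqrt_inner stiefel_inner)

lemma mult_diagonal:
  fixes A :: "'a::semiring_1^'k^'n"
  shows "A ** (\<chi> i j. if i = j then c i else 0) = (\<chi> i j. A $ i $ j * c j)"
  by (simp add: vec_eq_iff matrix_matrix_mult_def if_distrib cong: if_cong)

lemma diagonal_mult_vec:
  fixes x :: "'a::semiring_1^'k"
  shows "(\<chi> i j. if i = j then c i else 0) *v x = (\<chi> i. c i * x $ i)"
  by (simp add: vec_eq_iff matrix_vector_mult_def mult_delta_left)

lemma diagonal_quadratic:
  "x \<bullet> ((\<chi> i j. if i = j then complex_of_real (c i) else 0) *v x) = (\<Sum>i\<in>UNIV. c i * (cmod (x $ i))\<^sup>2)"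
  unfolding diagonal_mult_vec inner_vec_def
  by (intro sum.cong refl)
    (simp add: inner_complex_def cmod_power2, simp add: power2_eq_square algebra_simps)

lemma norm_sq_vec: "(norm x)\<^sup>2 = (\<Sum>i\<in>UNIV. (norm (x $ i))\<^sup>2)"
  by (simp add: norm_vec_def L2_set_def sum_nonneg)

lemma finite_enumeration: "\<exists>e :: 'k::finite \<Rightarrow> nat. bij_betw e UNIV {..<CARD('k)}"
  using ex_bij_betw_finite_nat[of "UNIV :: 'k set"] by (simp add: lessThan_atLeast0)

lemma cols_stiefel:
  assumes "\<And>i j. i < m \<Longrightarrow> j < m \<Longrightarrow> cinner (u i) (u j) = (if i = j then 1 else 0)"
    and e: "bij_betw e (UNIV :: 'k set) {..<CARD('k)}" and "CARD('k) \<le> m"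
  shows "cols (\<lambda>j. u (e j)) \<in> (stiefel :: (complex^'k^'n) set)"
proof -
  have "e i < m" and "e i = e j \<longleftrightarrow> i = j" for i j
    using e assms(3) by (auto simp: bij_betw_def inj_eq dest: less_le_trans)
  then show ?thesis
    using assms(1) by (simp add: stiefel_iff ctranspose_cols_mult_cols mat_def vec_eq_iff)
qed

lemma cols_eigvecs:
  assumes "W = cols w" "W \<in> stiefel" "\<And>j. H *v w j = c j *\<^sub>R w j"
  shows "H ** W = W ** (\<chi> i j. if i = j then complex_of_real (c i) else 0)"
    and "ctranspose W ** H ** W = (\<chi> i j. if i = j then complex_of_real (c i) else 0)"
proof -
  show HW: "H ** W = W ** (\<chi> i j. if i = j then complex_of_real (c i) else 0)"
    using assms(3) by (simp add: assms(1) mult_diagonal mult_cols)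
      (simp add: cols_def vec_eq_iff scaleR_conv_of_real[where 'a=complex])
  show "ctranspose W ** H ** W = (\<chi> i j. if i = j then complex_of_real (c i) else 0)"
    using assms(2) by (simp add: HW matrix_mul_assoc stiefel_iff flip: matrix_mul_assoc[of _ H W])
qed

text \<open>The bridge between eigenvalues as sorted roots of the characteristic polynomial and
  eigenvalues as successive minima: the eigenvectors form a unitary matrix that diagonalizes
  \<open>H\<close>.\<close>

lemma hermitian_eigenbasis_eigval:
  fixes H :: "complex^'n^'n"
  assumes H: "hermitian H"
  obtains u where
    "\<And>i j. i < CARD('n) \<Longrightarrow> j < CARD('n) \<Longrightarrow> cinner (u i) (u j) = (if i = j then 1 else 0)"
    "\<And>i. i < CARD('n) \<Longrightarrow> H *v u i = eigval (Suc i) H *\<^sub>R u i"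
    "\<And>i x. i < CARD('n) \<Longrightarrow> (\<And>j. j < i \<Longrightarrow> cinner (u j) x = 0) \<Longrightarrow>
       eigval (Suc i) H * (norm x)\<^sup>2 \<le> x \<bullet> (H *v x)"
    "\<And>i j. i \<le> j \<Longrightarrow> j < CARD('n) \<Longrightarrow> eigval (Suc i) H \<le> eigval (Suc j) H"
proof -
  from hermitian_eigenbasis[OF H]
  obtain u l where on:
    "\<And>i j. i < CARD('n) \<Longrightarrow> j < CARD('n) \<Longrightarrow> cinner (u i) (u j) = (if i = j then 1 else 0)"
    and ev: "\<And>i. i < CARD('n) \<Longrightarrow> H *v u i = l i *\<^sub>R u i"
    and mn: "\<And>i x. i < CARD('n) \<Longrightarrow> (\<And>j. j < i \<Longrightarrow> cinner (u j) x = 0) \<Longrightarrow> l i * (norm x)\<^sup>2 \<le> x \<bullet> (H *v x)"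
    and mono: "\<And>i j. i \<le> j \<Longrightarrow> j < CARD('n) \<Longrightarrow> l i \<le> l j"
    by blast
  obtain e :: "'n \<Rightarrow> nat" where e: "bij_betw e UNIV {..<CARD('n)}"
    using finite_enumeration by blast
  define U where "U = cols (\<lambda>j. u (e j))"
  have U: "U \<in> stiefel" using cols_stiefel[OF on e] by (simp add: U_def)
  have "e j < CARD('n)" for j using e by (auto simp: bij_betw_def)
  then have HU: "H ** U = U ** (\<chi> i j. if i = j then complex_of_real (l (e i)) else 0)"
    by (intro cols_eigvecs(1)[OF U_def U] ev)
  have "invertible U" using U by (auto simp: stiefel_iff invertible_left_inverse)
  from eigval_similar_diagonal[OF HU this _ e mono]
  have "eigval (Suc i) H = l i" if "i < CARD('n)" for i using that by simp
  with on ev mn mono show ?thesis by (intro that[of u]) auto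
qed

lemma eigval_mono:
  fixes H :: "complex^'n^'n"
  assumes "hermitian H" "i \<ge> 1" "i \<le> j" "j \<le> CARD('n)"
  shows "eigval i H \<le> eigval j H"
proof -
  obtain i' j' where "i = Suc i'" "j = Suc j'" using assms by (cases i; cases j) auto
  then show ?thesis using assms by (auto intro: hermitian_eigenbasis_eigval[OF assms(1)])
qed

text \<open>The range of \<open>W\<close> is invariant under \<open>H\<close>, with spectrum at most
  \<open>a\<close> on it and at least \<open>b\<close> on its orthogonal complement. Quadratic forms
  replace eigenvalues here so that a perturbation of \<open>H\<close> enters additively.\<close>

definition splits :: "complex^'n^'n \<Rightarrow> complex^'k^'n \<Rightarrow> real \<Rightarrow> real \<Rightarrow> bool" where
  "splits H W a b \<longleftrightarrow> W \<in> stiefel \<and> H ** W = W ** (ctranspose W ** H ** W) \<and>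
     (\<forall>u. (W *v u) \<bullet> (H *v (W *v u)) \<le> a * (norm u)\<^sup>2) \<and>
     (\<forall>x. ctranspose W *v x = 0 \<longrightarrow> b * (norm x)\<^sup>2 \<le> x \<bullet> (H *v x))"

text \<open>The columns of \<open>W\<close> are the first k vectors of the ordered eigenbasis. The
  bound on the complement is guarded by k < n because the square case k = n is also used, where
  \<open>eigval (CARD('k) + 1)\<close> has no meaning.\<close>

lemma lower_eigvecs:
  fixes H :: "complex^'n^'n"
  assumes H: "hermitian H" and kn: "CARD('k) \<le> CARD('n)"
  obtains W :: "complex^'k^'n" where "W \<in> stiefel" "H ** W = W ** (ctranspose W ** H ** W)"
    "\<forall>u. (W *v u) \<bullet> (H *v (W *v u)) \<le> eigval CARD('k) H * (norm u)\<^sup>2"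
    "CARD('k) < CARD('n) \<longrightarrow> (\<forall>x. ctranspose W *v x = 0 \<longrightarrow>
       eigval (CARD('k) + 1) H * (norm x)\<^sup>2 \<le> x \<bullet> (H *v x))"
    "\<forall>j\<in>{1..CARD('k)}. eigval j (ctranspose W ** H ** W) = eigval j H"
proof -
  from hermitian_eigenbasis_eigval[OF H]
  obtain u where on:
    "\<And>i j. i < CARD('n) \<Longrightarrow> j < CARD('n) \<Longrightarrow> cinner (u i) (u j) = (if i = j then 1 else 0)"
    and ev: "\<And>i. i < CARD('n) \<Longrightarrow> H *v u i = eigval (Suc i) H *\<^sub>R u i"
    and mn: "\<And>i x. i < CARD('n) \<Longrightarrow> (\<And>j. j < i \<Longrightarrow> cinner (u j) x = 0) \<Longrightarrow>
       eigval (Suc i) H * (norm x)\<^sup>2 \<le> x \<bullet> (H *v x)"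
    and mono: "\<And>i j. i \<le> j \<Longrightarrow> j < CARD('n) \<Longrightarrow> eigval (Suc i) H \<le> eigval (Suc j) H"
    by blast
  obtain e :: "'k \<Rightarrow> nat" where e: "bij_betw e UNIV {..<CARD('k)}"
    using finite_enumeration by blast
  then have ek: "e j < CARD('k)" for j by (auto simp: bij_betw_def)
  then have en: "e j < CARD('n)" for j using kn less_le_trans by blast
  define W where "W = cols (\<lambda>j. u (e j))"
  define L where "L = (\<chi> i j. if i = j then complex_of_real (eigval (Suc (e i)) H) else 0 :: complex^'k^'k)"
  have W: "W \<in> stiefel" using cols_stiefel[OF on e kn] by (simp add: W_def)
  have HW: "H ** W = W ** L" and WHW: "ctranspose W ** H ** W = L"
    unfolding L_def by (intro cols_eigvecs[OF W_def W] ev en)+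
  have "(W *v v) \<bullet> (H *v (W *v v)) \<le> eigval CARD('k) H * (norm v)\<^sup>2" for v
  proof -
    have "(W *v v) \<bullet> (H *v (W *v v)) = v \<bullet> (L *v v)"
      by (simp add: inner_mult_left matrix_vector_mul_assoc WHW[symmetric] matrix_mul_assoc)
    also have "\<dots> = (\<Sum>i\<in>UNIV. eigval (Suc (e i)) H * (cmod (v $ i))\<^sup>2)"
      unfolding L_def by (rule diagonal_quadratic)
    also have "\<dots> \<le> (\<Sum>i\<in>UNIV. eigval CARD('k) H * (cmod (v $ i))\<^sup>2)"
      using eigval_mono[OF H] ek kn by (intro sum_mono mult_right_mono) (auto simp: Suc_le_eq)
    finally show ?thesis by (simp add: norm_sq_vec sum_distrib_left)
  qed
  moreover have "eigval (CARD('k) + 1) H * (norm x)\<^sup>2 \<le> x \<bullet> (H *v x)"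
    if "CARD('k) < CARD('n)" "ctranspose W *v x = 0" for x
  proof -
    have "cinner (u j) x = 0" if j: "j < CARD('k)" for j
    proof -
      obtain i where "j = e i" using e j by (auto simp: bij_betw_def set_eq_iff image_iff)
      then show ?thesis using \<open>ctranspose W *v x = 0\<close>
        by (simp add: W_def ctranspose_cols_mult_vec vec_eq_iff)
    qed
    with mn[OF that(1)] show ?thesis by simp
  qed
  moreover have "eigval j (ctranspose W ** H ** W) = eigval j H" if "j \<in> {1..CARD('k)}" for j
  proof -
    obtain i where i: "j = Suc i" "i < CARD('k)" using \<open>j \<in> _\<close> by (cases j) auto
    \<comment> \<open>\<open>L\<close> is already diagonal, so the identity serves as the
      diagonalizing matrix.\<close>
    have "eigval (Suc i) L = eigval (Suc i) H"
      using mono kn i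
      by (intro eigval_similar_diagonal[where U = "mat 1" and D = L and e = e
            and l = "\<lambda>i. eigval (Suc i) H"] e) (auto simp: L_def invertible_def intro: exI[of _ "mat 1"])
    then show ?thesis by (simp add: i WHW)
  qed
  moreover have "H ** W = W ** (ctranspose W ** H ** W)"
    by (simp only: WHW HW)
  ultimately show ?thesis
    using W by (intro that[of W]) auto
qed

text \<open>With as many columns as rows the frame of lower eigenvectors is unitary, so every vector
  lies in its range.\<close>

lemma quadratic_le_eigval:
  fixes L :: "complex^'k^'k"
  assumes "hermitian L"
  shows "u \<bullet> (L *v u) \<le> eigval CARD('k) L * (norm u)\<^sup>2"
proof -
  obtain W :: "complex^'k^'k" where W: "W \<in> stiefel"
    "\<forall>u. (W *v u) \<bullet> (L *v (W *v u)) \<le> eigval CARD('k) L * (norm u)\<^sup>2"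
    by (rule lower_eigvecs[OF assms order_refl])
  have "W *v (ctranspose W *v u) = u"
    using W(1) by (simp add: stiefel_iff matrix_vector_mul_assoc matrix_left_right_inverse)
  then show ?thesis using W(2)[rule_format, of "ctranspose W *v u"] stiefel_norm[OF W(1)] by metis
qed

text \<open>An invariant subspace whose top eigenvalue is the k-th of \<open>H\<close> must be the
  lower one. If some \<open>x\<close> orthogonal to \<open>V\<close> had Rayleigh quotient below the
  (k+1)-st eigenvalue, the (k+1)-dimensional span of \<open>V\<close> and \<open>x\<close> would
  meet the complement of the lower eigenvectors in a nonzero vector, where the form is too
  large.\<close>

lemma solution_splits:
  fixes V :: "complex^'k^'n"
  assumes H: "hermitian H" and kn: "CARD('k) < CARD('n)" and V: "V \<in> stiefel"
    and HV: "H ** V = V ** (ctranspose V ** H ** V)"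
    and top: "eigval CARD('k) (ctranspose V ** H ** V) = eigval CARD('k) H"
    and gap: "eigval CARD('k) H < eigval (CARD('k) + 1) H"
  shows "splits H V (eigval CARD('k) H) (eigval (CARD('k) + 1) H)"
proof -
  define a b where "a = eigval CARD('k) H" and "b = eigval (CARD('k) + 1) H"
  have up: "(V *v u) \<bullet> (H *v (V *v u)) \<le> a * (norm u)\<^sup>2" for u
    using quadratic_le_eigval[OF hermitian_congruence[OF H], of u V]
    by (simp add: inner_mult_left top a_def matrix_vector_mul_assoc matrix_mul_assoc)
  have "b * (norm x)\<^sup>2 \<le> x \<bullet> (H *v x)" if x: "ctranspose V *v x = 0" for x
  proof (rule ccontr)
    assume neg: "\<not> ?thesis"
    obtain W :: "complex^'k^'n" where W:
      "CARD('k) < CARD('n) \<longrightarrow> (\<forall>x. ctranspose W *v x = 0 \<longrightarrow> b * (norm x)\<^sup>2 \<le> x \<bullet> (H *v x))"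
      unfolding b_def by (rule lower_eigvecs[OF H less_imp_le[OF kn]])
    \<comment> \<open>There are k orthogonality conditions and k + 1 coefficients;
      \<open>None\<close> stands for the coefficient of \<open>x\<close>.\<close>
    have "card (UNIV :: 'k set) < card (UNIV :: 'k option set)" by simp
    from underdetermined_system[OF _ _ this, of "\<lambda>i j. case j of
      None \<Rightarrow> (ctranspose W *v x) $ i | Some j \<Rightarrow> (ctranspose W ** V) $ i $ j"]
    obtain c where c: "\<exists>j. c j \<noteq> 0" "\<And>i. (ctranspose W *v x) $ i * c None
        + (\<Sum>j\<in>UNIV. (ctranspose W ** V) $ i $ j * c (Some j)) = 0"
      by (auto simp: UNIV_option_conv sum.reindex)
    define t where "t = c None"
    define r where "r = (\<chi> j. c (Some j))"
    define y where "y = V *v r + t *s x"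
    have "ctranspose W *v y = 0"
      using c(2) by (simp add: y_def t_def r_def matrix_vector_right_distrib vec.scale
          matrix_vector_mul_assoc vec_eq_iff)
        (simp add: matrix_vector_mult_def algebra_simps)
    then have "b * (norm y)\<^sup>2 \<le> y \<bullet> (H *v y)" using W kn by blast
    have Vtx: "ctranspose V *v (t *s x) = 0" by (simp add: vec.scale x)
    have o1: "(V *v r) \<bullet> (t *s x) = 0" by (simp add: inner_mult_left Vtx)
    have HVr: "H *v (V *v r) = V *v (ctranspose V ** H ** V *v r)"
      by (metis HV matrix_vector_mul_assoc)
    have o2: "(t *s x) \<bullet> (H *v (V *v r)) = 0"
      by (simp add: HVr inner_mult_right Vtx)
    have o3: "(V *v r) \<bullet> (H *v (t *s x)) = 0"
      using o2 hermitian_inner[OF H] by (metis inner_commute)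
    have "(t *s x) \<bullet> (H *v (t *s x)) = (cmod t)\<^sup>2 * (x \<bullet> (H *v x))"
    proof -
      have "cinner (t *s x) (H *v (t *s x)) = of_real ((cmod t)\<^sup>2) * cinner x (H *v x)"
        by (simp add: vec.scale cinner_scale_left cinner_scale_right
            complex_norm_square[symmetric] mult.assoc[symmetric] mult.commute[of "cnj t"])
      then show ?thesis by (simp flip: Re_cinner)
    qed
    then have "y \<bullet> (H *v y) \<le> a * (norm r)\<^sup>2 + (cmod t)\<^sup>2 * (x \<bullet> (H *v x))"
      using up[of r] o2 o3 by (simp add: y_def matrix_vector_right_distrib inner_add_left inner_add_right)
    moreover have "(norm y)\<^sup>2 = (norm (V *v r))\<^sup>2 + (norm (t *s x))\<^sup>2"
      using norm_add_Pythagorean o1 by (simp add: y_def orthogonal_def)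
    then have "(norm y)\<^sup>2 = (norm r)\<^sup>2 + (cmod t)\<^sup>2 * (norm x)\<^sup>2"
      by (simp add: stiefel_norm[OF V] norm_scale power_mult_distrib)
    \<comment> \<open>The form has no cross terms, so the deficits of the two components add. Both
      are nonnegative, and the strict inequalities force \<open>r\<close> and \<open>t\<close> to
      vanish.\<close>
    ultimately have "(b - a) * (norm r)\<^sup>2 + (cmod t)\<^sup>2 * (b * (norm x)\<^sup>2 - x \<bullet> (H *v x)) \<le> 0"
      using \<open>b * (norm y)\<^sup>2 \<le> y \<bullet> (H *v y)\<close> by (simp add: algebra_simps)
    moreover have "(b - a) * (norm r)\<^sup>2 \<ge> 0" "(cmod t)\<^sup>2 * (b * (norm x)\<^sup>2 - x \<bullet> (H *v x)) \<ge> 0"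
      using gap neg by (auto simp: a_def b_def)
    ultimately have "(b - a) * (norm r)\<^sup>2 = 0" "(cmod t)\<^sup>2 * (b * (norm x)\<^sup>2 - x \<bullet> (H *v x)) = 0"
      by linarith+
    then have "r = 0" "t = 0" using gap neg by (auto simp: a_def b_def)
    then have "c j = 0" for j by (cases j) (auto simp: r_def t_def vec_eq_iff)
    with c(1) show False by simp
  qed
  with V HV up show ?thesis by (simp add: splits_def a_def b_def)
qed

lemma splitsD:
  assumes "splits H W a b"
  shows "W \<in> stiefel" and "H *v (W *v u) = W *v ((ctranspose W ** H ** W) *v u)"
    and "(W *v u) \<bullet> (H *v (W *v u)) \<le> a * (norm u)\<^sup>2"
    and "ctranspose W *v x = 0 \<Longrightarrow> b * (norm x)\<^sup>2 \<le> x \<bullet> (H *v x)"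
proof -
  have "H ** W = W ** (ctranspose W ** H ** W)" using assms unfolding splits_def by blast
  then show "H *v (W *v u) = W *v ((ctranspose W ** H ** W) *v u)"
    by (simp only: matrix_vector_mul_assoc)
qed (use assms in \<open>unfold splits_def, blast+\<close>)

section \<open>Weyl bounds for the eigenvalues next to the gap\<close>

lemma quadratic_perturbation:
  fixes H H' :: "complex^'n^'n"
  assumes "\<forall>x. norm ((H' - H) *v x) \<le> \<epsilon> * norm x"
  shows "\<bar>x \<bullet> (H' *v x) - x \<bullet> (H *v x)\<bar> \<le> \<epsilon> * (norm x)\<^sup>2"
proof -
  have "x \<bullet> (H' *v x) - x \<bullet> (H *v x) = x \<bullet> ((H' - H) *v x)"
    by (simp add: matrix_vector_mult_diff_rdistrib inner_diff_right)
  also have "\<bar>\<dots>\<bar> \<le> norm x * norm ((H' - H) *v x)"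
    by (rule Cauchy_Schwarz_ineq2)
  also have "\<dots> \<le> norm x * (\<epsilon> * norm x)"
    using assms by (intro mult_left_mono) auto
  finally show ?thesis by (simp add: power2_eq_square ac_simps)
qed

text \<open>The k-dimensional range of \<open>V\<close> contains a nonzero vector orthogonal to the
  first k - 1 eigenvectors of \<open>H'\<close>. There the form of \<open>H'\<close> is at least its
  k-th eigenvalue, while that of \<open>H\<close> is at most \<open>a\<close>.\<close>

lemma splits_eigval_le:
  fixes H H' :: "complex^'n^'n" and V :: "complex^'k^'n"
  assumes H': "hermitian H'" and V: "splits H V a b" and kn: "CARD('k) \<le> CARD('n)"
    and near: "\<forall>x. norm ((H' - H) *v x) \<le> \<epsilon> * norm x"
  shows "eigval CARD('k) H' \<le> a + \<epsilon>"
proof -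
  obtain m where m: "CARD('k) = Suc m" using not0_implies_Suc[of "CARD('k)"] by auto
  from hermitian_eigenbasis_eigval[OF H']
  obtain u where on:
    "\<And>i j. i < CARD('n) \<Longrightarrow> j < CARD('n) \<Longrightarrow> cinner (u i) (u j) = (if i = j then 1 else 0)"
    and ev: "\<And>i. i < CARD('n) \<Longrightarrow> H' *v u i = eigval (Suc i) H' *\<^sub>R u i"
    and mn: "\<And>i x. i < CARD('n) \<Longrightarrow> (\<And>j. j < i \<Longrightarrow> cinner (u j) x = 0) \<Longrightarrow>
       eigval (Suc i) H' * (norm x)\<^sup>2 \<le> x \<bullet> (H' *v x)"
    and mono: "\<And>i j. i \<le> j \<Longrightarrow> j < CARD('n) \<Longrightarrow> eigval (Suc i) H' \<le> eigval (Suc j) H'"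
    by blast
  have "card {..<m} < card (UNIV :: 'k set)" by (simp add: m)
  from underdetermined_system[OF _ _ this, of "\<lambda>i j. cnj ((ctranspose V *v u i) $ j)"]
  obtain c where c: "\<exists>j. c j \<noteq> 0" "\<forall>i<m. (\<Sum>j\<in>UNIV. cnj ((ctranspose V *v u i) $ j) * c j) = 0"
    by auto
  define r where "r = (\<chi> j. c j)"
  define x where "x = V *v r"
  have "cinner (u i) x = 0" if "i < m" for i
    using c(2) that by (simp add: x_def cinner_mult_right) (simp add: cinner_def r_def)
  then have "eigval (Suc m) H' * (norm x)\<^sup>2 \<le> x \<bullet> (H' *v x)"
    using kn m by (intro mn) auto
  also have "\<dots> \<le> x \<bullet> (H *v x) + \<epsilon> * (norm x)\<^sup>2"
    using quadratic_perturbation[OF near, of x] by linarith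
  also have "\<dots> \<le> a * (norm x)\<^sup>2 + \<epsilon> * (norm x)\<^sup>2"
    using splitsD(3)[OF V, of r] by (simp add: x_def stiefel_norm[OF splitsD(1)[OF V]])
  finally have "eigval (Suc m) H' * (norm x)\<^sup>2 \<le> (a + \<epsilon>) * (norm x)\<^sup>2"
    by (simp add: algebra_simps)
  moreover have "r \<noteq> 0" using c(1) by (auto simp: r_def vec_eq_iff)
  then have "norm x > 0"
    by (simp add: x_def stiefel_norm[OF splitsD(1)[OF V]])
  ultimately show ?thesis by (simp add: m)
qed

text \<open>Dual to the upper bound: the span of the first k + 1 eigenvectors of \<open>H'\<close>
  meets the complement of \<open>V\<close>. There the form of \<open>H\<close> is at least
  \<open>b\<close>, while that of \<open>H'\<close> is at most its (k+1)-st eigenvalue.\<close>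

lemma splits_eigval_ge:
  fixes H H' :: "complex^'n^'n" and V :: "complex^'k^'n"
  assumes H': "hermitian H'" and V: "splits H V a b" and kn: "CARD('k) < CARD('n)"
    and near: "\<forall>x. norm ((H' - H) *v x) \<le> \<epsilon> * norm x"
  shows "b - \<epsilon> \<le> eigval (CARD('k) + 1) H'"
proof -
  from hermitian_eigenbasis_eigval[OF H']
  obtain u where on:
    "\<And>i j. i < CARD('n) \<Longrightarrow> j < CARD('n) \<Longrightarrow> cinner (u i) (u j) = (if i = j then 1 else 0)"
    and ev: "\<And>i. i < CARD('n) \<Longrightarrow> H' *v u i = eigval (Suc i) H' *\<^sub>R u i"
    and mn: "\<And>i x. i < CARD('n) \<Longrightarrow> (\<And>j. j < i \<Longrightarrow> cinner (u j) x = 0) \<Longrightarrow>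
       eigval (Suc i) H' * (norm x)\<^sup>2 \<le> x \<bullet> (H' *v x)"
    and mono: "\<And>i j. i \<le> j \<Longrightarrow> j < CARD('n) \<Longrightarrow> eigval (Suc i) H' \<le> eigval (Suc j) H'"
    by blast
  define l where "l i = eigval (Suc i) H'" for i
  note ev = ev[folded l_def] and mono = mono[folded l_def]
  \<comment> \<open>The eigenvectors are numbered from 0, so the indices up to k inclusive are k + 1
    unknowns for k equations.\<close>
  have "card (UNIV :: 'k set) < card {..CARD('k)}" by simp
  from underdetermined_system[OF _ _ this, of "\<lambda>i j. (ctranspose V *v u j) $ i"]
  obtain c where c: "\<exists>j\<le>CARD('k). c j \<noteq> 0"
      "\<forall>i. (\<Sum>j\<le>CARD('k). (ctranspose V *v u j) $ i * c j) = 0"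
    by auto
  define x where "x = (\<Sum>j\<le>CARD('k). c j *s u j)"
  have "ctranspose V *v x = 0"
    using c(2) by (simp add: x_def vec.sum vec.scale vec_eq_iff mult.commute)
  then have "b * (norm x)\<^sup>2 \<le> x \<bullet> (H *v x)"
    by (rule splitsD(4)[OF V])
  also have "\<dots> \<le> x \<bullet> (H' *v x) + \<epsilon> * (norm x)\<^sup>2"
    using quadratic_perturbation[OF near, of x] by linarith
  finally have "(b - \<epsilon>) * (norm x)\<^sup>2 \<le> x \<bullet> (H' *v x)"
    by (simp add: algebra_simps)
  moreover have coef: "cinner (u i) x = c i" if i: "i \<le> CARD('k)" for i
  proof -
    have "cinner (u i) x = (\<Sum>j\<le>CARD('k). if j = i then c j else 0)"
      unfolding x_def cinner_sum_right cinner_scale_right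
      using kn i by (intro sum.cong) (auto simp: on)
    then show ?thesis using i by simp
  qed
  have cmod_sq: "w * cnj w = (of_real (cmod w))\<^sup>2" for w
    by (metis complex_norm_square of_real_power)
  have quad: "x \<bullet> (H' *v x) = (\<Sum>j\<le>CARD('k). l j * (cmod (c j))\<^sup>2)"
  proof -
    have "cinner x (H' *v x) = (\<Sum>j\<le>CARD('k). cnj (c j) * cinner (u j) (H' *v x))"
      by (subst x_def) (simp add: cinner_sum_left cinner_scale_left)
    also have "\<dots> = (\<Sum>j\<le>CARD('k). of_real (l j * (cmod (c j))\<^sup>2))"
    proof (rule sum.cong[OF refl])
      fix j assume "j \<in> {..CARD('k)}"
      then have j: "j < CARD('n)" "j \<le> CARD('k)" using kn by auto
      show "cnj (c j) * cinner (u j) (H' *v x) = of_real (l j * (cmod (c j))\<^sup>2)"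
        by (simp add: cinner_hermitian_eigvec[OF H' ev[OF j(1)]] coef[OF j(2)] cmod_sq[symmetric] ac_simps)
    qed
    finally show ?thesis by (simp flip: Re_cinner)
  qed
  have norm_x: "(norm x)\<^sup>2 = (\<Sum>j\<le>CARD('k). (cmod (c j))\<^sup>2)"
  proof -
    have "cinner x x = (\<Sum>j\<le>CARD('k). cnj (c j) * cinner (u j) x)"
      by (subst x_def) (simp add: cinner_sum_left cinner_scale_left)
    also have "\<dots> = (\<Sum>j\<le>CARD('k). of_real ((cmod (c j))\<^sup>2))"
      by (intro sum.cong) (simp_all add: coef cmod_sq[symmetric] ac_simps)
    finally have "complex_of_real ((norm x)\<^sup>2) = of_real (\<Sum>j\<le>CARD('k). (cmod (c j))\<^sup>2)"
      by (simp only: cinner_self of_real_sum)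
    then show ?thesis by (simp only: of_real_eq_iff)
  qed
  have "x \<bullet> (H' *v x) \<le> (\<Sum>j\<le>CARD('k). l CARD('k) * (cmod (c j))\<^sup>2)"
    unfolding quad using mono kn by (intro sum_mono mult_right_mono) auto
  then have "x \<bullet> (H' *v x) \<le> l CARD('k) * (norm x)\<^sup>2"
    by (simp add: norm_x sum_distrib_left)
  moreover obtain j where "j \<le> CARD('k)" "c j \<noteq> 0" using c(1) by blast
  then have "(norm x)\<^sup>2 > 0"
    unfolding norm_x by (intro sum_pos2[of _ j]) auto
  ultimately have "b - \<epsilon> \<le> l CARD('k)"
    by (meson mult_right_le_imp_le order_trans)
  then show ?thesis by (simp add: l_def)
qed

text \<open>Apply the minimum principle, with no constraints, to the negative of
  \<open>ctranspose Z ** Z\<close>. The number \<open>s\<close> is then the operator norm of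
  \<open>Z\<close>, attained at \<open>u\<close>.\<close>

lemma max_singular_vector:
  fixes Z :: "complex^'k^'n"
  obtains u s where "norm u = 1" "s \<ge> 0" "ctranspose Z *v (Z *v u) = s\<^sup>2 *\<^sub>R u"
    "\<forall>y. norm (Z *v y) \<le> s * norm y"
proof -
  define M where "M = ctranspose Z ** Z"
  have M: "y \<bullet> (M *v y) = (norm (Z *v y))\<^sup>2" for y
    by (simp add: M_def norm_sq_inner inner_mult_left matrix_vector_mul_assoc)
  have neg: "(- M) *v y = - (M *v y)" for y
    by (simp add: vec_eq_iff matrix_vector_mult_def sum_negf)
  have "hermitian (- M)"
    using hermitian_gram[of Z] by (simp add: hermitian_def M_def vec_eq_iff)
  then obtain u l where u: "norm u = 1" "(- M) *v u = l *\<^sub>R u" "\<forall>y. l * (norm y)\<^sup>2 \<le> y \<bullet> ((- M) *v y)"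
    using hermitian_min_eigvec[of "- M" "{}" "axis undefined 1"] by (auto simp: axis_eq_0_iff)
  have "M *v u = - ((- M) *v u)" by (simp add: neg)
  then have Mu: "M *v u = (- l) *\<^sub>R u" by (simp add: u(2))
  have "(norm (Z *v u))\<^sup>2 = - l"
    using u(1) by (simp add: Mu flip: M norm_sq_inner)
  then have l: "- l \<ge> 0" by (metis zero_le_power2)
  show ?thesis
  proof (rule that[of u "sqrt (- l)"])
    show "ctranspose Z *v (Z *v u) = (sqrt (- l))\<^sup>2 *\<^sub>R u"
      using Mu l by (simp add: M_def matrix_vector_mul_assoc)
    show "\<forall>y. norm (Z *v y) \<le> sqrt (- l) * norm y"
    proof
      fix y
      have "l * (norm y)\<^sup>2 \<le> - (norm (Z *v y))\<^sup>2"
        using u(3)[rule_format, of y] by (simp only: neg inner_minus_right M)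
      then have "(norm (Z *v y))\<^sup>2 \<le> - l * (norm y)\<^sup>2" by linarith
      also have "\<dots> = (sqrt (- l) * norm y)\<^sup>2"
        by (simp only: power_mult_distrib real_sqrt_pow2[OF l])
      finally show "norm (Z *v y) \<le> sqrt (- l) * norm y"
        by (rule power2_le_imp_le) (use l in simp)
    qed
  qed (use u(1) l in simp_all)
qed

text \<open>
  The \<open>sin 2\<Theta>\<close> theorem, with \<open>s = tan \<theta>\<close> for the largest canonical angle \<open>\<theta>\<close>. For a unit vector \<open>u\<close>
  at which \<open>\<parallel>Z u\<parallel> = s\<close>, put \<open>y = V u\<close> and \<open>p = Z u\<close>; then \<open>x = y + p\<close> lies in the range of \<open>W\<close> and
  \<open>z = p - s\<^sup>2 y\<close> is orthogonal to it, so \<open>H\<close> is diagonal on the pair \<open>y, p\<close> and \<open>H'\<close> on the pair \<open>x, z\<close>.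
  Comparing the two compressions off the diagonal bounds \<open>sin 2\<theta>\<close>, and on the diagonal gives \<open>s < 1\<close>.
\<close>
lemma splits_perturbation:
  fixes H H' :: "complex^'n^'n" and V W :: "complex^'k^'n"
  assumes H: "hermitian H" and H': "hermitian H'"
    and V: "splits H V a b" and W: "splits H' W a' b'"
    and near: "\<forall>x. norm ((H' - H) *v x) \<le> \<epsilon> * norm x"
    and eps: "2 * \<epsilon> < b - a" and gap: "a' < b'" "a' < b - \<epsilon>"
  obtains Z T s where "W = (V + Z) ** T" "ctranspose V ** Z = 0"
    "\<forall>u. norm (Z *v u) \<le> s * norm u" "0 \<le> s" "s < 1" "s * (b - a) \<le> \<epsilon> * (1 + s\<^sup>2)"
proof -
  have VS: "V \<in> stiefel" and WS: "W \<in> stiefel" using splitsD(1)[OF V] splitsD(1)[OF W] by auto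
  define T where "T = ctranspose V ** W"
  \<comment> \<open>A kernel vector of \<open>T\<close> would put \<open>W *v v\<close> in the
    complement of \<open>V\<close>, where \<open>H\<close> is at least \<open>b\<close> and
    \<open>H'\<close> at least \<open>b - \<epsilon>\<close>, contrary to
    \<open>a' < b - \<epsilon>\<close>. So the range of \<open>W\<close> is a graph over that of
    \<open>V\<close>.\<close>
  have "v = 0" if "T *v v = 0" for v
  proof (rule ccontr)
    assume "v \<noteq> 0"
    define x where "x = W *v v"
    have "ctranspose V *v x = 0" using that by (simp add: x_def T_def matrix_vector_mul_assoc)
    then have "b * (norm x)\<^sup>2 \<le> x \<bullet> (H *v x)" by (rule splitsD(4)[OF V])
    moreover have "x \<bullet> (H' *v x) \<le> a' * (norm x)\<^sup>2"
      using splitsD(3)[OF W, of v] by (simp add: x_def stiefel_norm[OF WS])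
    moreover have "norm x > 0" using \<open>v \<noteq> 0\<close> stiefel_norm[OF WS] by (simp add: x_def)
    then have "a' * (norm x)\<^sup>2 < (b - \<epsilon>) * (norm x)\<^sup>2" using gap by simp
    ultimately show False
      using quadratic_perturbation[OF near, of x] by (simp add: algebra_simps)
  qed
  then obtain Ti where Ti: "Ti ** T = mat 1" using matrix_left_invertible_ker[of T] by blast
  then have Ti': "T ** Ti = mat 1" using matrix_left_right_inverse by blast
  define Z where "Z = W ** Ti - V"
  have WT: "W = (V + Z) ** T" by (simp add: Z_def Ti flip: matrix_mul_assoc)
  have VZ: "ctranspose V ** Z = 0"
    using VS by (simp add: Z_def matrix_mult_diff_right matrix_mul_assoc stiefel_iff Ti' flip: T_def)
  then have ZV: "ctranspose Z ** V = 0"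
    by (metis ctranspose_0 ctranspose_ctranspose ctranspose_mult)
  obtain u s where u: "norm u = 1" "s \<ge> 0" "ctranspose Z *v (Z *v u) = s\<^sup>2 *\<^sub>R u"
    and Zs: "\<forall>y. norm (Z *v y) \<le> s * norm y"
    by (rule max_singular_vector)
  define y where "y = V *v u"
  define p where "p = Z *v u"
  define x where "x = y + p"
  define z where "z = p - s\<^sup>2 *\<^sub>R y"
  define N where "N = 1 + s\<^sup>2"
  have N: "N > 0" by (simp add: N_def add_pos_nonneg)
  have uu: "u \<bullet> u = 1" using u(1) by (simp flip: norm_sq_inner)
  have yy: "y \<bullet> y = 1" by (simp add: y_def stiefel_inner[OF VS] uu)
  have pp: "p \<bullet> p = s\<^sup>2" by (simp add: p_def inner_mult_left u(3) uu)
  have Vp: "ctranspose V *v p = 0" and Zy: "ctranspose Z *v y = 0"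
    by (simp_all add: p_def y_def matrix_vector_mul_assoc VZ ZV)
  have Vy: "ctranspose V *v y = u" using VS by (simp add: y_def matrix_vector_mul_assoc stiefel_iff)
  have yp: "y \<bullet> p = 0" by (simp add: y_def inner_mult_left Vp)
  have xx: "x \<bullet> x = N" and zz: "z \<bullet> z = s\<^sup>2 * N"
    by (simp_all add: x_def z_def N_def inner_add_left inner_add_right inner_diff_left inner_diff_right
        yy pp yp inner_commute[of p y] power2_eq_square algebra_simps)
  have xW: "x = W *v (Ti *v u)"
    by (simp add: x_def y_def p_def Z_def matrix_vector_mult_diff_rdistrib matrix_vector_mul_assoc)
  have "ctranspose W *v z = ctranspose T *v ((ctranspose V + ctranspose Z) *v z)"
    by (simp add: WT ctranspose_mult ctranspose_add matrix_vector_mul_assoc)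
  also have "(ctranspose V + ctranspose Z) *v z = 0"
    by (simp add: z_def matrix_vector_mult_add_rdistrib matrix_vector_mult_diff_distrib mult_scaleR
        Vp Zy Vy u(3) flip: p_def) (simp add: p_def u(3))
  finally have Wz: "ctranspose W *v z = 0" by simp
  have inv: "H *v y = V *v ((ctranspose V ** H ** V) *v u)"
    unfolding y_def by (rule splitsD(2)[OF V])
  have inv': "H' *v x = W *v ((ctranspose W ** H' ** W) *v (Ti *v u))"
    unfolding xW by (rule splitsD(2)[OF W])
  have zHx: "z \<bullet> (H' *v x) = 0" by (simp add: inv' inner_mult_right Wz)
  then have xHz: "x \<bullet> (H' *v z) = 0" using hermitian_inner[OF H'] by (metis inner_commute)
  have pHy: "p \<bullet> (H *v y) = 0" by (simp add: inv inner_mult_right Vp)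
  then have yHp: "y \<bullet> (H *v p) = 0" using hermitian_inner[OF H] by (metis inner_commute)
  define A where "A = y \<bullet> (H *v y)"
  define B where "B = p \<bullet> (H *v p)"
  have A: "A \<le> a"
    using splitsD(3)[OF V, of u] by (simp add: u(1) A_def y_def)
  have B: "b * s\<^sup>2 \<le> B"
    using splitsD(4)[OF V Vp] by (simp add: B_def norm_sq_inner pp)
  have "s\<^sup>2 * A \<le> s\<^sup>2 * a" using A by (intro mult_left_mono) auto
  with B have BA: "s\<^sup>2 * (b - a) \<le> B - s\<^sup>2 * A" by (simp add: algebra_simps)
  \<comment> \<open>The off-diagonal entry for the pair \<open>x\<close>, \<open>z\<close>: it
    vanishes for \<open>H'\<close>, and for \<open>H\<close> it expands into diagonal entries
    because the mixed terms in \<open>y\<close> and \<open>p\<close> vanish.\<close>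
  have "z \<bullet> ((H' - H) *v x) = - (B - s\<^sup>2 * A)"
    using zHx pHy yHp by (simp add: matrix_vector_mult_diff_rdistrib inner_diff_right)
      (simp add: x_def z_def A_def B_def inner_add_right inner_diff_left matrix_vector_right_distrib)
  then have "B - s\<^sup>2 * A \<le> norm z * norm ((H' - H) *v x)"
    using Cauchy_Schwarz_ineq2[of z "(H' - H) *v x"] by simp
  also have "\<dots> \<le> norm z * (\<epsilon> * norm x)" using near by (intro mult_left_mono) auto
  also have "\<dots> = \<epsilon> * (s * N)"
    using N u(2) by (simp add: norm_eq_sqrt_inner xx zz real_sqrt_mult)
  finally have main: "s\<^sup>2 * (b - a) \<le> \<epsilon> * (s * N)" using BA by simp
  have sin2: "s * (b - a) \<le> \<epsilon> * (1 + s\<^sup>2)"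
  proof (cases "s = 0")
    case True
    have "0 \<le> norm ((H' - H) *v y)" by simp
    also have "\<dots> \<le> \<epsilon> * norm y" using near by blast
    also have "norm y = 1" by (simp add: norm_eq_sqrt_inner yy)
    finally show ?thesis using True by simp
  next
    case False
    have "s * (s * (b - a)) \<le> s * (\<epsilon> * N)" using main by (simp add: power2_eq_square ac_simps)
    then show ?thesis using False u(2) by (simp add: N_def mult_le_cancel_left)
  qed
  have "s < 1"
  proof (cases "s = 0")
    case False
    then have s: "s > 0" using u(2) by simp
    define a1 where "a1 = x \<bullet> (H' *v x)"
    define b1 where "b1 = z \<bullet> (H' *v z)"
    have a1: "a1 \<le> a' * N"
    proof -
      have "(norm (Ti *v u))\<^sup>2 = N"
        using stiefel_norm[OF WS, of "Ti *v u"] xx by (simp add: norm_sq_inner[symmetric] flip: xW)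
      then show ?thesis using splitsD(3)[OF W, of "Ti *v u"] by (simp add: a1_def flip: xW)
    qed
    have b1: "b' * (s\<^sup>2 * N) \<le> b1"
      using splitsD(4)[OF W Wz] by (simp add: b1_def norm_sq_inner zz)
    \<comment> \<open>Up to the factor \<open>N\<close>, \<open>y\<close> and \<open>p\<close> are
      combinations of \<open>x\<close> and \<open>z\<close>, on which the form of \<open>H'\<close>
      is diagonal.\<close>
    have Np: "N *\<^sub>R p = s\<^sup>2 *\<^sub>R x + z" and Ny: "N *\<^sub>R y = x - z"
      by (simp_all add: N_def x_def z_def algebra_simps)
    have "N\<^sup>2 * (p \<bullet> (H' *v p)) = (N *\<^sub>R p) \<bullet> (H' *v (N *\<^sub>R p))"
      by (simp add: mult_scaleR power2_eq_square)
    also have "\<dots> = s\<^sup>2 * s\<^sup>2 * a1 + b1"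
      unfolding Np using zHx xHz by (simp add: a1_def b1_def matrix_vector_right_distrib mult_scaleR
          inner_add_left inner_add_right)
    finally have P: "N\<^sup>2 * (p \<bullet> (H' *v p)) = s\<^sup>2 * s\<^sup>2 * a1 + b1" .
    have "N\<^sup>2 * (y \<bullet> (H' *v y)) = (N *\<^sub>R y) \<bullet> (H' *v (N *\<^sub>R y))"
      by (simp add: mult_scaleR power2_eq_square)
    also have "\<dots> = a1 + b1"
      unfolding Ny using zHx xHz by (simp add: a1_def b1_def matrix_vector_mult_diff_distrib
          inner_diff_left inner_diff_right)
    finally have Y: "N\<^sup>2 * (y \<bullet> (H' *v y)) = a1 + b1" .
    have "B - \<epsilon> * s\<^sup>2 \<le> p \<bullet> (H' *v p)"
      using quadratic_perturbation[OF near, of p] by (simp add: B_def pp norm_sq_inner)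
    moreover have "y \<bullet> (H' *v y) \<le> A + \<epsilon>"
      using quadratic_perturbation[OF near, of y] by (simp add: A_def yy norm_sq_inner)
    then have "s\<^sup>2 * (y \<bullet> (H' *v y)) \<le> s\<^sup>2 * (A + \<epsilon>)" by (intro mult_left_mono) auto
    moreover have "0 < s\<^sup>2 * (b - a - 2 * \<epsilon>)" using s eps by simp
    \<comment> \<open>Passing from \<open>H\<close> to \<open>H'\<close> costs
      \<open>\<epsilon>\<close> in each of the two forms, which the assumption
      \<open>2 * \<epsilon> < b - a\<close> absorbs.\<close>
    ultimately have "0 < p \<bullet> (H' *v p) - s\<^sup>2 * (y \<bullet> (H' *v y))"
      using BA by (simp add: algebra_simps)
    then have "0 < N\<^sup>2 * (p \<bullet> (H' *v p) - s\<^sup>2 * (y \<bullet> (H' *v y)))" using N by simp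
    also have "\<dots> = (s\<^sup>2 * s\<^sup>2 * a1 + b1) - s\<^sup>2 * (a1 + b1)"
      by (simp add: right_diff_distrib P mult.left_commute[of _ "s\<^sup>2"] Y)
    also have "\<dots> = (1 - s\<^sup>2) * (b1 - s\<^sup>2 * a1)" by (simp add: algebra_simps)
    finally have "0 < (1 - s\<^sup>2) * (b1 - s\<^sup>2 * a1)" .
    \<comment> \<open>The gap of \<open>H'\<close> makes the second factor positive, so
      \<open>1 - s\<^sup>2\<close> must be positive as well.\<close>
    moreover have "0 < b1 - s\<^sup>2 * a1"
    proof -
      have "s\<^sup>2 * a1 \<le> s\<^sup>2 * (a' * N)" using a1 by (intro mult_left_mono) auto
      also have "\<dots> < s\<^sup>2 * (b' * N)" using s N gap by simp
      also have "\<dots> \<le> b1" using b1 by (simp add: ac_simps)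
      finally show ?thesis by simp
    qed
    ultimately have "s\<^sup>2 < 1" by (simp add: zero_less_mult_iff)
    then show ?thesis using s by (simp add: abs_square_less_1)
  qed simp
  show ?thesis by (rule that[OF WT VZ Zs u(2) \<open>s < 1\<close> sin2])
qed

section \<open>Subspaces as graphs\<close>

text \<open>For an orthonormal eigenbasis of the Gram matrix \<open>ctranspose A ** A\<close>, the
  images under \<open>A\<close> are orthogonal with squared lengths \<open>l\<close>. Injectivity
  makes these positive, so dividing by their roots gives an orthonormal frame.\<close>

lemma stiefel_of_injective:
  fixes A :: "complex^'k^'n"
  assumes inj: "\<And>x. A *v x = 0 \<Longrightarrow> x = 0"
  shows "\<exists>T :: complex^'k^'k. A ** T \<in> stiefel"
proof -
  define G where "G = ctranspose A ** A"
  have G: "hermitian G" unfolding G_def by (rule hermitian_gram)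
  from hermitian_eigenbasis_eigval[OF G]
  obtain u where on:
    "\<And>i j. i < CARD('k) \<Longrightarrow> j < CARD('k) \<Longrightarrow> cinner (u i) (u j) = (if i = j then 1 else 0)"
    and ev: "\<And>i. i < CARD('k) \<Longrightarrow> G *v u i = eigval (Suc i) G *\<^sub>R u i"
    and mn: "\<And>i x. i < CARD('k) \<Longrightarrow> (\<And>j. j < i \<Longrightarrow> cinner (u j) x = 0) \<Longrightarrow>
       eigval (Suc i) G * (norm x)\<^sup>2 \<le> x \<bullet> (G *v x)"
    and mono: "\<And>i j. i \<le> j \<Longrightarrow> j < CARD('k) \<Longrightarrow> eigval (Suc i) G \<le> eigval (Suc j) G"
    by blast
  define l where "l i = eigval (Suc i) G" for i
  have l_pos: "l i > 0" if i: "i < CARD('k)" for i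
  proof -
    have uu: "u i \<bullet> u i = 1" using on[OF i i] by (simp flip: Re_cinner)
    have "l i = u i \<bullet> (G *v u i)" by (simp add: ev[OF i] uu l_def)
    also have "\<dots> = (norm (A *v u i))\<^sup>2"
      by (simp add: G_def norm_sq_inner inner_mult_left matrix_vector_mul_assoc)
    also have "\<dots> > 0" using inj[of "u i"] uu by auto
    finally show ?thesis .
  qed
  obtain e :: "'k \<Rightarrow> nat" where e: "bij_betw e UNIV {..<CARD('k)}"
    using finite_enumeration by blast
  then have ek: "e j < CARD('k)" and e_inj: "e i = e j \<longleftrightarrow> i = j" for i j
    by (auto simp: bij_betw_def inj_eq)
  define t where "t j = (1 / sqrt (l (e j))) *\<^sub>R u (e j)" for j
  have "cinner (A *v t i) (A *v t j) = (if i = j then 1 else 0)" for i j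
  proof -
    have "cinner (A *v t i) (A *v t j) = cinner (t i) (G *v t j)"
      using cinner_mult_right[of "t i" "ctranspose A" "A *v t j"] by (simp add: G_def matrix_vector_mul_assoc)
    also have "\<dots> = of_real (l (e j) / sqrt (l (e j))) * cinner (t i) (u (e j))"
      by (simp add: t_def[of j] mult_scaleR ev[OF ek] l_def cinner_scaleR_right)
    also have "cinner (t i) (u (e j)) = of_real (1 / sqrt (l (e i))) * cinner (u (e i)) (u (e j))"
      by (subst (1 2) cnj_cinner[symmetric]) (simp add: t_def cinner_scaleR_right)
    finally show ?thesis
      using l_pos[OF ek, of i] by (auto simp: on ek e_inj simp flip: of_real_mult)
  qed
  then have "A ** cols t \<in> stiefel"
    by (simp add: stiefel_iff mult_cols[of A] ctranspose_cols_mult_cols mat_def vec_eq_iff)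
  then show ?thesis by blast
qed

lemma stiefel_residual:
  assumes "W \<in> stiefel"
  shows "ctranspose W *v (x - W *v (ctranspose W *v x)) = 0"
    and "(norm (x - W *v (ctranspose W *v x)))\<^sup>2 = (norm x)\<^sup>2 - (norm (ctranspose W *v x))\<^sup>2"
proof -
  have WW: "ctranspose W *v (W *v v) = v" for v
    using assms by (simp add: stiefel_iff matrix_vector_mul_assoc)
  show 1: "ctranspose W *v (x - W *v (ctranspose W *v x)) = 0"
    by (simp add: matrix_vector_mult_diff_distrib WW)
  have "orthogonal (x - W *v (ctranspose W *v x)) (W *v (ctranspose W *v x))"
    by (simp add: orthogonal_def inner_mult_right 1)
  from norm_add_Pythagorean[OF this]
  show "(norm (x - W *v (ctranspose W *v x)))\<^sup>2 = (norm x)\<^sup>2 - (norm (ctranspose W *v x))\<^sup>2"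
    by (simp add: stiefel_norm[OF assms])
qed

lemma proj_mult_vec: "proj W *v x = W *v (ctranspose W *v x)"
  by (simp add: proj_def matrix_vector_mul_assoc)

lemma stiefel_norm_ctranspose_le:
  assumes "W \<in> stiefel"
  shows "norm (ctranspose W *v x) \<le> norm x"
  using stiefel_residual(2)[OF assms, of x] zero_le_power2
  by (metis diff_ge_0_iff_ge norm_ge_zero power2_le_imp_le)

text \<open>The hypotheses bound all cosines of canonical angles below by
  \<open>1 / sqrt (1 + s\<^sup>2)\<close>; the conclusion is the matching sine bound for the
  difference of projections. Each projection accounts for one of two orthogonal parts.\<close>

lemma proj_distance:
  fixes V W :: "complex^'k^'n"
  assumes V: "V \<in> stiefel" and W: "W \<in> stiefel"
    and VW: "\<And>u. (norm u)\<^sup>2 \<le> (1 + s\<^sup>2) * (norm (ctranspose V *v (W *v u)))\<^sup>2"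
    and WV: "\<And>u. (norm u)\<^sup>2 \<le> (1 + s\<^sup>2) * (norm (ctranspose W *v (V *v u)))\<^sup>2"
  shows "(1 + s\<^sup>2) * (norm ((proj W - proj V) *v x))\<^sup>2 \<le> s\<^sup>2 * (norm x)\<^sup>2"
proof -
  define a where "a = ctranspose V *v x"
  define y where "y = x - V *v a"
  define b where "b = ctranspose W *v y"
  define q where "q = V *v a - W *v (ctranspose W *v (V *v a))"
  have Vy: "ctranspose V *v y = 0" and y: "(norm y)\<^sup>2 = (norm x)\<^sup>2 - (norm a)\<^sup>2"
    using stiefel_residual[OF V, of x] by (simp_all add: y_def a_def)
  have Wq: "ctranspose W *v q = 0"
    and q: "(norm q)\<^sup>2 = (norm a)\<^sup>2 - (norm (ctranspose W *v (V *v a)))\<^sup>2"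
    using stiefel_residual[OF W, of "V *v a"] by (simp_all add: q_def stiefel_norm[OF V])
  \<comment> \<open>Splitting \<open>x\<close> into \<open>V *v a\<close> and \<open>y\<close>
    leaves the projection of \<open>y\<close> onto the range of \<open>W\<close> minus the part of
    \<open>V *v a\<close> orthogonal to that range.\<close>
  have "(proj W - proj V) *v x = W *v b + - q"
    by (simp add: matrix_vector_mult_diff_rdistrib proj_mult_vec b_def q_def y_def a_def
        matrix_vector_mult_diff_distrib)
  moreover have "orthogonal (W *v b) (- q)" by (simp add: orthogonal_def inner_mult_left Wq)
  ultimately have split: "(norm ((proj W - proj V) *v x))\<^sup>2 = (norm b)\<^sup>2 + (norm q)\<^sup>2"
    using norm_add_Pythagorean[of "W *v b" "- q"] by (simp add: stiefel_norm[OF W])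
  have q_le: "(1 + s\<^sup>2) * (norm q)\<^sup>2 \<le> s\<^sup>2 * (norm a)\<^sup>2"
    using WV[of a] by (simp add: q algebra_simps)
  have b_le: "(1 + s\<^sup>2) * (norm b)\<^sup>2 \<le> s\<^sup>2 * (norm y)\<^sup>2"
  proof (cases "b = 0")
    case False
    define r where "r = W *v b - V *v (ctranspose V *v (W *v b))"
    have r: "(norm r)\<^sup>2 = (norm b)\<^sup>2 - (norm (ctranspose V *v (W *v b)))\<^sup>2"
      using stiefel_residual(2)[OF V, of "W *v b"] by (simp add: r_def stiefel_norm[OF W])
    have r_le: "(1 + s\<^sup>2) * (norm r)\<^sup>2 \<le> s\<^sup>2 * (norm b)\<^sup>2"
      using VW[of b] by (simp add: r algebra_simps)
    \<comment> \<open>Duality: since \<open>y\<close> is orthogonal to \<open>V\<close>, only the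
      component \<open>r\<close> of \<open>W *v b\<close> orthogonal to \<open>V\<close> pairs with
      \<open>y\<close>, and that component is small.\<close>
    have "b \<bullet> b = (W *v b) \<bullet> y" by (simp add: inner_mult_left b_def)
    also have "\<dots> = r \<bullet> y" by (simp add: r_def inner_diff_left inner_mult_left Vy)
    also have "\<dots> \<le> norm r * norm y" by (rule norm_cauchy_schwarz)
    finally have "(norm b)\<^sup>2 \<le> norm r * norm y" by (simp add: norm_sq_inner)
    then have "((norm b)\<^sup>2)\<^sup>2 \<le> (norm r * norm y)\<^sup>2" by (intro power_mono) auto
    then have "(1 + s\<^sup>2) * ((norm b)\<^sup>2)\<^sup>2 \<le> (1 + s\<^sup>2) * (norm r * norm y)\<^sup>2"
      by (intro mult_left_mono) auto
    also have "\<dots> = ((1 + s\<^sup>2) * (norm r)\<^sup>2) * (norm y)\<^sup>2" by (simp add: power_mult_distrib)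
    also have "\<dots> \<le> (s\<^sup>2 * (norm b)\<^sup>2) * (norm y)\<^sup>2" using r_le by (intro mult_right_mono) auto
    finally have "(norm b)\<^sup>2 * ((1 + s\<^sup>2) * (norm b)\<^sup>2) \<le> (norm b)\<^sup>2 * (s\<^sup>2 * (norm y)\<^sup>2)"
      by (simp add: power2_eq_square[of "(norm b)\<^sup>2"] ac_simps)
    then show ?thesis using False by simp
  qed simp
  have "(1 + s\<^sup>2) * (norm ((proj W - proj V) *v x))\<^sup>2 \<le> s\<^sup>2 * (norm y)\<^sup>2 + s\<^sup>2 * (norm a)\<^sup>2"
    using q_le b_le by (simp add: split distrib_left)
  then show ?thesis by (simp add: y algebra_simps)
qed

lemma graph_norm:
  fixes V Z :: "complex^'k^'n"
  assumes V: "V \<in> stiefel" and VZ: "ctranspose V ** Z = 0"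
  shows "(norm ((V + Z) *v u))\<^sup>2 = (norm u)\<^sup>2 + (norm (Z *v u))\<^sup>2"
proof -
  have "orthogonal (V *v u) (Z *v u)"
    by (simp add: orthogonal_def inner_mult_left matrix_vector_mul_assoc VZ)
  from norm_add_Pythagorean[OF this] show ?thesis
    by (simp add: matrix_vector_mult_add_rdistrib stiefel_norm[OF V])
qed

lemma graph_frame_exists:
  fixes V Z :: "complex^'k^'n"
  assumes V: "V \<in> stiefel" and VZ: "ctranspose V ** Z = 0"
  shows "\<exists>T :: complex^'k^'k. (V + Z) ** T \<in> stiefel"
proof (rule stiefel_of_injective)
  fix u assume "(V + Z) *v u = 0"
  with graph_norm[OF V VZ, of u] have "(norm u)\<^sup>2 + (norm (Z *v u))\<^sup>2 = 0" by simp
  then show "u = 0" by (simp add: add_nonneg_eq_0_iff)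
qed

text \<open>Orthonormality of \<open>W\<close> says that \<open>T ** ctranspose T\<close> inverts
  \<open>mat 1 + ctranspose Z ** Z\<close>. A bound \<open>s\<close> on the tangents in
  \<open>Z\<close> thus becomes a lower bound on the cosines, the singular values of
  \<open>T\<close>; the last two claims give it for \<open>T\<close> and for its adjoint.\<close>

lemma graph_frame:
  fixes V Z :: "complex^'k^'n"
  assumes V: "V \<in> stiefel" and VZ: "ctranspose V ** Z = 0"
    and W: "W \<in> stiefel" "W = (V + Z) ** T"
  shows "ctranspose V ** W = T"
    and "(T ** ctranspose T) ** (mat 1 + ctranspose Z ** Z) = mat 1"
    and "\<forall>u. norm (Z *v u) \<le> s * norm u \<Longrightarrow> (norm u)\<^sup>2 \<le> (1 + s\<^sup>2) * (norm (ctranspose V *v (W *v u)))\<^sup>2"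
    and "\<forall>u. norm (Z *v u) \<le> s * norm u \<Longrightarrow> (norm u)\<^sup>2 \<le> (1 + s\<^sup>2) * (norm (ctranspose W *v (V *v u)))\<^sup>2"
proof -
  show VW: "ctranspose V ** W = T"
    using V by (simp add: W(2) matrix_mul_assoc matrix_add_ldistrib stiefel_iff VZ)
  have ZV: "ctranspose Z ** V = 0"
    using VZ by (metis ctranspose_0 ctranspose_ctranspose ctranspose_mult)
  have gram: "ctranspose (V + Z) ** (V + Z) = mat 1 + ctranspose Z ** Z"
    using V by (simp add: ctranspose_add matrix_add_ldistrib matrix_mult_add_left stiefel_iff VZ ZV)
  have "ctranspose T ** (mat 1 + ctranspose Z ** Z) ** T = mat 1"
    using W(1) unfolding stiefel_iff W(2) ctranspose_mult gram[symmetric]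
    by (simp add: matrix_mul_assoc)
  then have TT: "T ** (ctranspose T ** (mat 1 + ctranspose Z ** Z)) = mat 1"
    by (simp add: matrix_left_right_inverse)
  then show "(T ** ctranspose T) ** (mat 1 + ctranspose Z ** Z) = mat 1"
    by (simp add: matrix_mul_assoc)
  assume Zs: "\<forall>u. norm (Z *v u) \<le> s * norm u"
  have *: "(norm v)\<^sup>2 \<le> (1 + s\<^sup>2) * (norm (T *v v))\<^sup>2" for v
  proof -
    have "(norm v)\<^sup>2 = (norm ((V + Z) *v (T *v v)))\<^sup>2"
      using stiefel_norm[OF W(1), of v] by (simp add: W(2) matrix_vector_mul_assoc)
    also have "\<dots> = (norm (T *v v))\<^sup>2 + (norm (Z *v (T *v v)))\<^sup>2"
      by (rule graph_norm[OF V VZ])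
    also have "(norm (Z *v (T *v v)))\<^sup>2 \<le> (s * norm (T *v v))\<^sup>2"
      using Zs by (intro power_mono) auto
    finally show ?thesis by (simp add: power_mult_distrib algebra_simps)
  qed
  then show "(norm u)\<^sup>2 \<le> (1 + s\<^sup>2) * (norm (ctranspose V *v (W *v u)))\<^sup>2"
    by (simp add: matrix_vector_mul_assoc VW)
  \<comment> \<open>The preimage of \<open>u\<close> under \<open>T\<close>; Cauchy-Schwarz then
    transfers the bound from \<open>T\<close> to its adjoint.\<close>
  define v where "v = (ctranspose T ** (mat 1 + ctranspose Z ** Z)) *v u"
  have u: "u = T *v v" by (simp add: v_def matrix_vector_mul_assoc TT)
  have WV: "ctranspose W ** V = ctranspose T"
    by (metis VW ctranspose_ctranspose ctranspose_mult)
  have "(norm u)\<^sup>2 = v \<bullet> (ctranspose T *v u)"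
    by (simp add: norm_sq_inner inner_mult_right flip: u)
  also have "\<dots> \<le> norm v * norm (ctranspose T *v u)" by (rule norm_cauchy_schwarz)
  finally have "((norm u)\<^sup>2)\<^sup>2 \<le> (norm v * norm (ctranspose T *v u))\<^sup>2" by (intro power_mono) auto
  also have "\<dots> = (norm v)\<^sup>2 * (norm (ctranspose T *v u))\<^sup>2" by (simp add: power_mult_distrib)
  also have "\<dots> \<le> ((1 + s\<^sup>2) * (norm u)\<^sup>2) * (norm (ctranspose T *v u))\<^sup>2"
    using *[of v] by (intro mult_right_mono) (auto simp flip: u)
  finally have sq: "(norm u)\<^sup>2 * (norm u)\<^sup>2 \<le> (norm u)\<^sup>2 * ((1 + s\<^sup>2) * (norm (ctranspose T *v u))\<^sup>2)"
    by (simp add: power2_eq_square[of "(norm u)\<^sup>2"] ac_simps)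
  have "(norm u)\<^sup>2 \<le> (1 + s\<^sup>2) * (norm (ctranspose T *v u))\<^sup>2"
  proof (cases "u = 0")
    case False
    then show ?thesis by (intro mult_left_le_imp_le[OF sq]) simp
  qed simp
  then show "(norm u)\<^sup>2 \<le> (1 + s\<^sup>2) * (norm (ctranspose W *v (V *v u)))\<^sup>2"
    by (simp add: matrix_vector_mul_assoc WV)
qed

section \<open>From cosine bounds to the canonical angles\<close>

lemma index_num_range: "index_num (i :: 'k::finite) \<in> {1..CARD('k)}"
proof -
  obtain h where "bij_betw h {1..CARD('k)} (UNIV :: 'k set)"
    using ex_bij_betw_nat_finite_1[of "UNIV :: 'k set"] by auto
  then have "\<exists>e. bij_betw e (UNIV :: 'k set) {1..CARD('k)}" using bij_betw_inv by blast
  then have "bij_betw index_num (UNIV :: 'k set) {1..CARD('k)}"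
    unfolding index_num_def by (rule someI_ex)
  then show ?thesis by (auto simp: bij_betw_def)
qed

lemma mat_norm2_diagonal_le:
  fixes D :: "real^'k^'k"
  assumes "\<And>i. \<bar>c i\<bar> \<le> t"
  shows "mat_norm2 (\<chi> i j. if i = j then c i else 0 :: real^'k^'k) \<le> t"
  unfolding mat_norm2_def
proof (rule onorm_le)
  fix x :: "real^'k"
  have t: "t \<ge> 0" using assms[of undefined] by linarith
  have "(norm ((\<chi> i j. if i = j then c i else 0) *v x))\<^sup>2 = (\<Sum>i\<in>UNIV. (c i)\<^sup>2 * (x $ i)\<^sup>2)"
    by (simp add: diagonal_mult_vec norm_sq_vec power_mult_distrib)
  also have "\<dots> \<le> (\<Sum>i\<in>UNIV. t\<^sup>2 * (x $ i)\<^sup>2)"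
    using assms t by (intro sum_mono mult_right_mono) (auto simp: abs_le_square_iff[symmetric])
  also have "\<dots> = (t * norm x)\<^sup>2" by (simp add: norm_sq_vec power_mult_distrib sum_distrib_left)
  finally show "norm ((\<chi> i j. if i = j then c i else 0) *v x) \<le> t * norm x"
    by (rule power2_le_imp_le) (use t in simp)
qed

text \<open>The squared singular values \<open>l\<close> of \<open>ctranspose X ** V\<close> are
  values of its Gram form at unit eigenvectors. The hypothesis gives
  \<open>1 \<le> (1 + s\<^sup>2) * l\<close>, and the sine of the angle is
  \<open>sqrt (1 - l)\<close>.\<close>

lemma stiefel_nbhd_I:
  fixes X V :: "complex^'k^'n"
  assumes X: "X \<in> stiefel" and V: "V \<in> stiefel" and s: "s \<ge> 0"
    and XV: "\<And>u. (norm u)\<^sup>2 \<le> (1 + s\<^sup>2) * (norm (ctranspose X *v (V *v u)))\<^sup>2"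
  shows "X \<in> stiefel_nbhd (s / sqrt (1 + s\<^sup>2)) V"
proof -
  define M where "M = ctranspose X ** V"
  define G where "G = ctranspose M ** M"
  have G: "hermitian G" unfolding G_def by (rule hermitian_gram)
  have N: "1 + s\<^sup>2 > 0" by (simp add: add_pos_nonneg)
  have "\<bar>sin (arccos (singval j M))\<bar> \<le> s / sqrt (1 + s\<^sup>2)" if j: "j \<in> {1..CARD('k)}" for j
  proof -
    obtain i where i: "j = Suc i" "i < CARD('k)" using j by (cases j) auto
    from hermitian_eigenbasis_eigval[OF G]
    obtain u where on:
      "\<And>i j. i < CARD('k) \<Longrightarrow> j < CARD('k) \<Longrightarrow> cinner (u i) (u j) = (if i = j then 1 else 0)"
      and ev: "\<And>i. i < CARD('k) \<Longrightarrow> G *v u i = eigval (Suc i) G *\<^sub>R u i"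
      and "\<And>i x. i < CARD('k) \<Longrightarrow> (\<And>j. j < i \<Longrightarrow> cinner (u j) x = 0) \<Longrightarrow>
         eigval (Suc i) G * (norm x)\<^sup>2 \<le> x \<bullet> (G *v x)"
      and "\<And>i j. i \<le> j \<Longrightarrow> j < CARD('k) \<Longrightarrow> eigval (Suc i) G \<le> eigval (Suc j) G"
      by blast
    define l where "l = eigval j G"
    have uu: "u i \<bullet> u i = 1" using on[OF i(2) i(2)] by (simp flip: Re_cinner)
    have u1: "norm (u i) = 1" by (simp add: norm_eq_sqrt_inner uu)
    have "l = u i \<bullet> (G *v u i)" by (simp add: ev[OF i(2)] uu l_def i)
    also have "\<dots> = (norm (M *v u i))\<^sup>2"
      by (simp add: G_def norm_sq_inner inner_mult_left matrix_vector_mul_assoc)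
    finally have l: "l = (norm (M *v u i))\<^sup>2" .
    have "norm (M *v u i) \<le> 1"
      using stiefel_norm_ctranspose_le[OF X, of "V *v u i"]
      by (simp add: M_def stiefel_norm[OF V] u1 flip: matrix_vector_mul_assoc)
    then have l1: "l \<le> 1" and l0: "l \<ge> 0" by (simp_all add: l power_le_one)
    have "1 \<le> (1 + s\<^sup>2) * l"
      using XV[of "u i"] by (simp add: l u1 M_def matrix_vector_mul_assoc)
    then have "1 - l \<le> s\<^sup>2 / (1 + s\<^sup>2)" using N by (simp add: field_simps)
    moreover have "sin (arccos (singval j M)) = sqrt (1 - l)"
    proof -
      have "sqrt l \<ge> 0" using l0 by simp
      then have "- 1 \<le> sqrt l" by linarith
      moreover have "sqrt l \<le> 1" using l1 by simp
      ultimately show ?thesis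
        using sin_arccos[of "sqrt l"] l0 by (simp add: singval_def flip: G_def l_def)
    qed
    moreover have "sqrt (s\<^sup>2 / (1 + s\<^sup>2)) = s / sqrt (1 + s\<^sup>2)"
      using s by (simp add: real_sqrt_divide)
    ultimately show ?thesis using l1 by (metis abs_of_nonneg diff_ge_0_iff_ge real_sqrt_ge_zero real_sqrt_le_mono)
  qed
  then have "\<bar>sin (arccos (singval (index_num i) M))\<bar> \<le> s / sqrt (1 + s\<^sup>2)" for i :: 'k
    using index_num_range by blast
  from mat_norm2_diagonal_le[of "\<lambda>i. sin (arccos (singval (index_num i) M))", OF this]
  have "mat_norm2 (sin_diag (can_angles X V)) \<le> s / sqrt (1 + s\<^sup>2)"
    by (simp add: sin_diag_def can_angles_def M_def cong: if_cong)
  with X show ?thesis by (simp add: stiefel_nbhd_def)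
qed

section \<open>Continuity of the lower spectral projection\<close>

lemma norm_mult_vec_le: "norm (A *v x) \<le> mat_norm2 A * norm x" for A :: "complex^'m^'n"
  unfolding mat_norm2_def by (intro onorm matrix_vector_mul_bounded_linear)

lemma mat_norm2_leI:
  fixes A :: "complex^'m^'n"
  assumes "\<And>x. norm (A *v x) \<le> c * norm x"
  shows "mat_norm2 A \<le> c"
  unfolding mat_norm2_def using assms by (rule onorm_le)

lemma mat_norm2_nonneg: "mat_norm2 A \<ge> 0" for A :: "complex^'m^'n"
  unfolding mat_norm2_def by (intro onorm_pos_le matrix_vector_mul_bounded_linear)

lemma mat_norm2_triangle: "mat_norm2 (A + B) \<le> mat_norm2 A + mat_norm2 B" for A B :: "complex^'m^'n"
  using onorm_triangle[OF matrix_vector_mul_bounded_linear[of A] matrix_vector_mul_bounded_linear[of B]]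
  by (simp add: mat_norm2_def matrix_vector_mult_add_rdistrib)

text \<open>The \<open>norm\<close> of the matrix type is the Frobenius norm, which governs
  continuity. By Cauchy-Schwarz on each row it dominates the operator norm.\<close>

lemma norm_mult_vec_le_norm: "norm (A *v x) \<le> norm A * norm x" for A :: "complex^'m^'n"
proof -
  have "norm ((A *v x) $ i) \<le> norm (A $ i) * norm x" for i
  proof -
    have "norm ((A *v x) $ i) \<le> (\<Sum>j\<in>UNIV. \<bar>norm (A $ i $ j)\<bar> * \<bar>norm (x $ j)\<bar>)"
      unfolding matrix_vector_mult_def by (simp add: sum_norm_le norm_mult)
    also have "\<dots> \<le> norm (A $ i) * norm x"
      unfolding norm_vec_def[of "A $ i"] norm_vec_def[of x] by (rule L2_set_mult_ineq)
    finally show ?thesis .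
  qed
  then have "norm (A *v x) \<le> L2_set (\<lambda>i. norm (A $ i) * norm x) UNIV"
    unfolding norm_vec_def[of "A *v x"] by (intro L2_set_mono) auto
  also have "\<dots> = norm A * norm x"
    by (simp add: norm_vec_def[of A] L2_set_left_distrib)
  finally show ?thesis .
qed

lemma mult_axis: "A *v axis j 1 = column j A" for A :: "'a::semiring_1^'m^'n"
  by (simp add: vec_eq_iff matrix_vector_mult_def column_def axis_def mult_delta_right)

text \<open>Each entry is a coordinate of the image of a unit vector. The crude constant suffices to
  turn operator bounds into convergence and boundedness of matrices.\<close>

lemma norm_le_operator_bound:
  fixes A :: "complex^'m^'n"
  assumes "\<And>x. norm (A *v x) \<le> c * norm x"
  shows "norm A \<le> real (CARD('n) * CARD('m)) * c"
proof -
  have "norm (A $ i $ j) \<le> c" for i j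
  proof -
    have "norm (A $ i $ j) = norm ((A *v axis j 1) $ i)"
      by (simp add: mult_axis column_def)
    also have "\<dots> \<le> norm (A *v axis j 1)" by (rule Finite_Cartesian_Product.norm_nth_le)
    also have "\<dots> \<le> c * norm (axis j 1 :: complex^'m)" by (rule assms)
    finally show ?thesis by (simp add: norm_eq_sqrt_inner[of "axis j 1"] inner_axis)
  qed
  then have "(\<Sum>i\<in>UNIV. \<Sum>j\<in>UNIV. norm (A $ i $ j)) \<le> (\<Sum>i\<in>(UNIV :: 'n set). \<Sum>j\<in>(UNIV :: 'm set). c)"
    by (intro sum_mono)
  moreover have "norm A \<le> (\<Sum>i\<in>UNIV. norm (A $ i))"
    unfolding norm_vec_def[of A] by (rule L2_set_le_sum) auto
  moreover have "norm (A $ i) \<le> (\<Sum>j\<in>UNIV. norm (A $ i $ j))" for i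
    unfolding norm_vec_def[of "A $ i"] by (rule L2_set_le_sum) auto
  then have "(\<Sum>i\<in>UNIV. norm (A $ i)) \<le> (\<Sum>i\<in>UNIV. \<Sum>j\<in>UNIV. norm (A $ i $ j))"
    by (intro sum_mono)
  ultimately show ?thesis by simp
qed

lemma mat_norm2_pos: "A \<noteq> 0 \<Longrightarrow> mat_norm2 A > 0" for A :: "complex^'m^'n"
  using norm_le_operator_bound[OF norm_mult_vec_le[of A]] mat_norm2_nonneg[of A]
  by (cases "mat_norm2 A = 0") auto

text \<open>Only the projection \<open>proj (low_frame H)\<close> depends continuously on \<open>H\<close>; the frame itself is chosen arbitrarily.\<close>
definition low_frame :: "complex^'n^'n \<Rightarrow> complex^'k^'n" where
  "low_frame H = (SOME W. splits H W (eigval CARD('k) H) (eigval (CARD('k) + 1) H) \<and>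
     (\<forall>j\<in>{1..CARD('k)}. eigval j (ctranspose W ** H ** W) = eigval j H))"

lemma low_frame:
  fixes H :: "complex^'n^'n"
  assumes H: "hermitian H" and kn: "CARD('k) < CARD('n)"
  shows "splits H (low_frame H :: complex^'k^'n) (eigval CARD('k) H) (eigval (CARD('k) + 1) H)"
    and "\<forall>j\<in>{1..CARD('k)}. eigval j (ctranspose (low_frame H :: complex^'k^'n) ** H ** low_frame H) = eigval j H"
proof -
  obtain W :: "complex^'k^'n" where W: "W \<in> stiefel" "H ** W = W ** (ctranspose W ** H ** W)"
    "\<forall>u. (W *v u) \<bullet> (H *v (W *v u)) \<le> eigval CARD('k) H * (norm u)\<^sup>2"
    "CARD('k) < CARD('n) \<longrightarrow> (\<forall>x. ctranspose W *v x = 0 \<longrightarrow>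
       eigval (CARD('k) + 1) H * (norm x)\<^sup>2 \<le> x \<bullet> (H *v x))"
    and ev: "\<forall>j\<in>{1..CARD('k)}. eigval j (ctranspose W ** H ** W) = eigval j H"
    by (rule lower_eigvecs[OF H less_imp_le[OF kn]])
  have "splits H W (eigval CARD('k) H) (eigval (CARD('k) + 1) H)"
    unfolding splits_def using W(1-3) W(4)[rule_format, OF kn] by (intro conjI) auto
  with ev have "splits H W (eigval CARD('k) H) (eigval (CARD('k) + 1) H) \<and>
     (\<forall>j\<in>{1..CARD('k)}. eigval j (ctranspose W ** H ** W) = eigval j H)" by (rule conjI[rotated])
  from someI[of "\<lambda>W. splits H W (eigval CARD('k) H) (eigval (CARD('k) + 1) H) \<and>
     (\<forall>j\<in>{1..CARD('k)}. eigval j (ctranspose W ** H ** W) = eigval j H)", OF this]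
  show "splits H (low_frame H :: complex^'k^'n) (eigval CARD('k) H) (eigval (CARD('k) + 1) H)"
    and "\<forall>j\<in>{1..CARD('k)}. eigval j (ctranspose (low_frame H :: complex^'k^'n) ** H ** low_frame H) = eigval j H"
    unfolding low_frame_def[symmetric] by (rule conjunct1, rule conjunct2)
qed

text \<open>Since \<open>s < 1\<close>, the factor \<open>1 + s\<^sup>2\<close> in the
  \<open>sin 2\<Theta>\<close> bound is at most 2, which makes the bound on \<open>s\<close> linear
  in \<open>\<epsilon>\<close>.\<close>

lemma splits_proj_distance:
  fixes H H' :: "complex^'n^'n" and V W :: "complex^'k^'n"
  assumes H: "hermitian H" and H': "hermitian H'"
    and V: "splits H V a b" and W: "splits H' W a' b'"
    and near: "\<forall>x. norm ((H' - H) *v x) \<le> \<epsilon> * norm x" and eps0: "\<epsilon> \<ge> 0"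
    and eps: "2 * \<epsilon> < b - a" and gap: "a' < b'" "a' < b - \<epsilon>"
  shows "norm ((proj W - proj V) *v x) \<le> 2 * \<epsilon> / (b - a) * norm x"
proof -
  obtain Z T s where WT: "W = (V + Z) ** T" and VZ: "ctranspose V ** Z = 0"
    and Zs: "\<forall>u. norm (Z *v u) \<le> s * norm u"
    and s: "0 \<le> s" "s < 1" "s * (b - a) \<le> \<epsilon> * (1 + s\<^sup>2)"
    by (rule splits_perturbation[OF H H' V W near eps gap])
  note frame = graph_frame[OF splitsD(1)[OF V] VZ splitsD(1)[OF W] WT]
  have "(1 + s\<^sup>2) * (norm ((proj W - proj V) *v x))\<^sup>2 \<le> s\<^sup>2 * (norm x)\<^sup>2"
    by (intro proj_distance splitsD(1)[OF V] splitsD(1)[OF W] frame(3,4) Zs)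
  moreover have "0 \<le> s\<^sup>2 * (norm ((proj W - proj V) *v x))\<^sup>2" by simp
  ultimately have "(norm ((proj W - proj V) *v x))\<^sup>2 \<le> (s * norm x)\<^sup>2"
    unfolding distrib_right power_mult_distrib by linarith
  then have "norm ((proj W - proj V) *v x) \<le> s * norm x"
    by (rule power2_le_imp_le) (use s in simp)
  also have "s\<^sup>2 \<le> 1" using s by (simp add: power_le_one)
  then have "\<epsilon> * (1 + s\<^sup>2) \<le> \<epsilon> * 2" using eps0 by (intro mult_left_mono) auto
  then have "s \<le> 2 * \<epsilon> / (b - a)" using s(3) eps eps0 by (simp add: pos_le_divide_eq)
  then have "s * norm x \<le> 2 * \<epsilon> / (b - a) * norm x" by (intro mult_right_mono) auto
  finally show ?thesis .
qed

lemma continuous_on_low_proj: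
  assumes kn: "CARD('k) < CARD('n)"
  shows "continuous_on {H :: complex^'n^'n. hermitian H \<and> eigval CARD('k) H < eigval (CARD('k) + 1) H}
    (\<lambda>H. proj (low_frame H :: complex^'k^'n))"
  unfolding continuous_on_iff
proof (intro ballI allI impI)
  fix H0 :: "complex^'n^'n" and e :: real
  assume "H0 \<in> {H. hermitian H \<and> eigval CARD('k) H < eigval (CARD('k) + 1) H}" and e: "e > 0"
  then have H0: "hermitian H0" and gap0: "eigval CARD('k) H0 < eigval (CARD('k) + 1) H0" by auto
  define a where "a = eigval CARD('k) H0"
  define b where "b = eigval (CARD('k) + 1) H0"
  define V :: "complex^'k^'n" where "V = low_frame H0"
  define C where "C = real (CARD('n) * CARD('n)) * (2 / (b - a))"
  have ab: "b - a > 0" using gap0 by (simp add: a_def b_def)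
  then have C: "C > 0" by (simp add: C_def)
  have V: "splits H0 V a b" unfolding a_def b_def V_def by (rule low_frame(1)[OF H0 kn])
  \<comment> \<open>The first term keeps \<open>2 * \<epsilon>\<close> below the gap at
    \<open>H0\<close>; the second makes the Lipschitz bound \<open>C * \<epsilon>\<close> smaller
    than \<open>e\<close>.\<close>
  define r where "r = min ((b - a) / 2) (e / C)"
  have r: "r > 0" using ab e C by (simp add: r_def)
  show "\<exists>r>0. \<forall>H\<in>{H. hermitian H \<and> eigval CARD('k) H < eigval (CARD('k) + 1) H}.
     dist H H0 < r \<longrightarrow> dist (proj (low_frame H :: complex^'k^'n)) (proj (low_frame H0 :: complex^'k^'n)) < e"
  proof (intro exI[of _ r] conjI ballI impI r)
    fix H :: "complex^'n^'n"
    assume "H \<in> {H. hermitian H \<and> eigval CARD('k) H < eigval (CARD('k) + 1) H}" and d: "dist H H0 < r"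
    then have H: "hermitian H" and gap: "eigval CARD('k) H < eigval (CARD('k) + 1) H" by auto
    define W :: "complex^'k^'n" where "W = low_frame H"
    define \<epsilon> where "\<epsilon> = norm (H - H0)"
    have \<epsilon>: "0 \<le> \<epsilon>" "\<epsilon> < (b - a) / 2" "\<epsilon> < e / C" using d by (auto simp: \<epsilon>_def r_def dist_norm)
    have near: "\<forall>x. norm ((H - H0) *v x) \<le> \<epsilon> * norm x"
      unfolding \<epsilon>_def by (intro allI norm_mult_vec_le_norm)
    have W: "splits H W (eigval CARD('k) H) (eigval (CARD('k) + 1) H)"
      unfolding W_def by (rule low_frame(1)[OF H kn])
    have "eigval CARD('k) H \<le> a + \<epsilon>"
      by (rule splits_eigval_le[OF H V less_imp_le[OF kn] near])
    then have "eigval CARD('k) H < b - \<epsilon>" using \<epsilon> by (simp add: field_simps)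
    moreover have "2 * \<epsilon> < b - a" using \<epsilon> by simp
    ultimately have "norm ((proj W - proj V) *v x) \<le> 2 * \<epsilon> / (b - a) * norm x" for x
      by (intro splits_proj_distance[OF H0 H V W near \<epsilon>(1) _ gap])
    then have "norm (proj W - proj V) \<le> real (CARD('n) * CARD('n)) * (2 * \<epsilon> / (b - a))"
      by (rule norm_le_operator_bound)
    also have "\<dots> = C * \<epsilon>" by (simp add: C_def)
    also have "\<dots> < e" using \<epsilon>(3) C by (simp add: pos_less_divide_eq mult.commute)
    finally show "dist (proj (low_frame H :: complex^'k^'n)) (proj (low_frame H0 :: complex^'k^'n)) < e"
      by (simp add: dist_norm W_def V_def)
  qed
qed

section \<open>Continuity of matrix inverses and graph coordinates\<close>

lemma continuous_on_det:
  fixes f :: "'a::topological_space \<Rightarrow> complex^'n^'n"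
  shows "continuous_on S f \<Longrightarrow> continuous_on S (\<lambda>x. det (f x))"
  unfolding det_def by (intro continuous_intros)

lemma matrix_inv_inverse:
  assumes "invertible A"
  shows "A ** matrix_inv A = mat 1" "matrix_inv A ** A = mat 1"
  using someI_ex[OF assms[unfolded invertible_def]] by (simp_all add: matrix_inv_def)

lemma matrix_inv_eqI:
  fixes A B :: "'a::field^'n^'n"
  assumes "B ** A = mat 1"
  shows "matrix_inv A = B"
proof -
  have AB: "A ** B = mat 1" using assms matrix_left_right_inverse by blast
  then have "invertible A" using assms by (auto simp: invertible_def)
  then have "matrix_inv A ** A = mat 1" by (rule matrix_inv_inverse)
  then have "matrix_inv A ** A ** B = B" by simp
  then show ?thesis by (simp add: AB flip: matrix_mul_assoc)
qed

text \<open>Cramer's rule applied to the unit vectors. Entries that are quotients of determinants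
  make the continuity of the inverse evident.\<close>

lemma matrix_inv_cramer:
  fixes A :: "complex^'n^'n"
  assumes "det A \<noteq> 0"
  shows "matrix_inv A = (\<chi> i j. det (\<chi> r c. if c = i then (if r = j then 1 else 0) else A $ r $ c) / det A)"
proof -
  have AA: "A ** matrix_inv A = mat 1"
    using assms by (intro matrix_inv_inverse) (simp add: invertible_det_nz)
  have "matrix_inv A $ i $ j
      = det (\<chi> r c. if c = i then (if r = j then 1 else 0) else A $ r $ c) / det A" for i j
  proof -
    have "A *v (matrix_inv A *v axis j 1) = axis j 1"
      by (simp add: matrix_vector_mul_assoc AA)
    then have "matrix_inv A *v axis j 1
        = (\<chi> k. det (\<chi> r c. if c = k then axis j 1 $ r else A $ r $ c) / det A)"
      using cramer[OF assms] by blast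
    then have "(matrix_inv A *v axis j 1) $ i
        = det (\<chi> r c. if c = i then axis j 1 $ r else A $ r $ c) / det A" by simp
    moreover have "axis j 1 $ r = (if r = j then 1 else 0 :: complex)" for r
      by (simp add: axis_def)
    ultimately show ?thesis
      unfolding mult_axis by (simp only: column_def vec_lambda_beta)
  qed
  then show ?thesis by (simp add: vec_eq_iff)
qed

lemma continuous_on_matrix_inv:
  fixes f :: "'a::topological_space \<Rightarrow> complex^'n^'n"
  assumes "continuous_on S f" "\<And>x. x \<in> S \<Longrightarrow> det (f x) \<noteq> 0"
  shows "continuous_on S (\<lambda>x. matrix_inv (f x))"
proof -
  have "continuous_on S (\<lambda>x. \<chi> i j. det (\<chi> r c. if c = i then (if r = j then 1 else 0) else f x $ r $ c) / det (f x))"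
  proof (intro continuous_on_vec_lambda continuous_on_divide continuous_on_det assms(1) ballI assms(2))
    fix i j r c
    show "continuous_on S (\<lambda>x. if c = i then (if r = j then 1 else 0) else f x $ r $ c)"
      by (cases "c = i") (auto intro!: continuous_intros assms(1))
  qed
  then show ?thesis
    by (rule continuous_on_cong[THEN iffD1, rotated 2]) (simp_all add: matrix_inv_cramer assms(2))
qed

lemma continuous_on_matrix_mult [continuous_intros]:
  fixes f :: "'a::topological_space \<Rightarrow> complex^'m^'n" and g :: "'a \<Rightarrow> complex^'k^'m"
  shows "continuous_on S f \<Longrightarrow> continuous_on S g \<Longrightarrow> continuous_on S (\<lambda>x. f x ** g x)"
  unfolding matrix_matrix_mult_def by (intro continuous_intros)

lemma continuous_on_ctranspose [continuous_intros]:
  "continuous_on S f \<Longrightarrow> continuous_on S (\<lambda>x. ctranspose (f x))"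
  unfolding ctranspose_def by (intro continuous_intros)

text \<open>The orthogonal projection onto the range of \<open>V + Z\<close> when
  \<open>ctranspose V ** Z = 0\<close>, in a form free of any choice of orthonormal frame and hence
  continuous in \<open>Z\<close>.\<close>

definition graph_proj :: "complex^'k^'n \<Rightarrow> complex^'k^'n \<Rightarrow> complex^'n^'n" where
  "graph_proj V Z = (V + Z) ** matrix_inv (mat 1 + ctranspose Z ** Z) ** ctranspose (V + Z)"

text \<open>The inverse chart, from a projection back to its graph coordinate: normalize the frame
  \<open>Q ** V\<close> of the range so that its component along \<open>V\<close> is the identity,
  then subtract \<open>V\<close>.\<close>

definition graph_of :: "complex^'k^'n \<Rightarrow> complex^'n^'n \<Rightarrow> complex^'k^'n" where
  "graph_of V Q = Q ** V ** matrix_inv (ctranspose V ** Q ** V) - V"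

text \<open>Everything follows from \<open>ctranspose V ** proj W ** V = T ** ctranspose T\<close>,
  the inverse of \<open>mat 1 + ctranspose Z ** Z\<close>. The two determinants are those required
  for continuity of the charts.\<close>

lemma proj_graph_frame:
  fixes V Z W :: "complex^'k^'n"
  assumes V: "V \<in> stiefel" and VZ: "ctranspose V ** Z = 0"
    and W: "W \<in> stiefel" "W = (V + Z) ** T"
  shows "proj W = graph_proj V Z" and "det (mat 1 + ctranspose Z ** Z) \<noteq> 0"
    and "graph_of V (proj W) = Z" and "det (ctranspose V ** proj W ** V) \<noteq> 0"
proof -
  define Q where "Q = T ** ctranspose T"
  define G where "G = mat 1 + ctranspose Z ** Z"
  have QG: "Q ** G = mat 1" unfolding Q_def G_def by (rule graph_frame(2)[OF V VZ W])
  then have GQ: "G ** Q = mat 1" using matrix_left_right_inverse by blast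
  have projW: "proj W = (V + Z) ** Q ** ctranspose (V + Z)"
    by (simp add: proj_def W(2) ctranspose_mult Q_def matrix_mul_assoc)
  then show "proj W = graph_proj V Z"
    using matrix_inv_eqI[OF QG] by (simp add: graph_proj_def G_def)
  show "det (mat 1 + ctranspose Z ** Z) \<noteq> 0"
    using QG GQ by (auto simp: G_def invertible_def simp flip: invertible_det_nz)
  have ZV: "ctranspose (V + Z) ** V = mat 1"
    using V VZ by (metis (no_types, lifting) ctranspose_0 ctranspose_add ctranspose_ctranspose
        ctranspose_mult matrix_mult_add_left stiefel_iff add.right_neutral)
  have QV: "proj W ** V = (V + Z) ** Q"
    by (simp add: projW ZV flip: matrix_mul_assoc)
  have VQV: "ctranspose V ** proj W ** V = Q"
    using V by (simp add: QV stiefel_iff matrix_add_ldistrib VZ matrix_mult_add_left matrix_mul_assoc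
        flip: matrix_mul_assoc[of _ "proj W"])
  show "det (ctranspose V ** proj W ** V) \<noteq> 0"
    unfolding VQV using QG GQ by (auto simp: invertible_def simp flip: invertible_det_nz)
  have "graph_of V (proj W) = (V + Z) ** Q ** G - V"
    unfolding graph_of_def VQV QV matrix_inv_eqI[OF GQ] ..
  also have "\<dots> = Z" by (simp add: QG flip: matrix_mul_assoc)
  finally show "graph_of V (proj W) = Z" .
qed

section \<open>The fixed point argument\<close>

lemma scaleR_mult_vec: "(r *\<^sub>R A) *v x = r *\<^sub>R (A *v x)" for A :: "complex^'m^'n"
  by (simp add: vec_eq_iff matrix_vector_mult_def scaleR_sum_right)

lemma matrix_mult_scaleR: "A ** (r *\<^sub>R B) = r *\<^sub>R (A ** B)" for A :: "complex^'m^'n"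
  by (simp add: vec_eq_iff matrix_matrix_mult_def scaleR_sum_right)

text \<open>Here \<open>\<eta>\<close> bounds the tangent of the largest canonical angle; the
  matching sine is \<open>\<eta> / sqrt (1 + \<eta>\<^sup>2)\<close>.\<close>

definition graph_ball :: "complex^'k^'n \<Rightarrow> real \<Rightarrow> (complex^'k^'n) set" where
  "graph_ball V \<eta> = {Z. ctranspose V ** Z = 0 \<and> (\<forall>u. norm (Z *v u) \<le> \<eta> * norm u)}"

lemma graph_ball_compact: "compact (graph_ball (V :: complex^'k^'n) \<eta>)"
proof -
  have "graph_ball V \<eta> = {Z. ctranspose V ** Z = 0} \<inter> (\<Inter>u. {Z. norm (Z *v u) \<le> \<eta> * norm u})"
    by (auto simp: graph_ball_def)
  moreover have "closed {Z :: complex^'k^'n. ctranspose V ** Z = 0}"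
    by (intro closed_Collect_eq continuous_intros)
  moreover have "closed {Z :: complex^'k^'n. norm (Z *v u) \<le> \<eta> * norm u}" for u
    unfolding matrix_vector_mult_def by (intro closed_Collect_le continuous_intros)
  ultimately have "closed (graph_ball V \<eta>)" by (simp add: closed_Int closed_INT)
  moreover have "bounded (graph_ball V \<eta>)"
    unfolding bounded_iff
    by (intro exI[of _ "real (CARD('n) * CARD('k)) * \<eta>"] ballI norm_le_operator_bound)
      (simp add: graph_ball_def)
  ultimately show ?thesis by (simp add: compact_eq_bounded_closed)
qed

lemma graph_ball_convex: "convex (graph_ball V \<eta>)"
proof (rule convexI)
  fix X Y and p q :: real
  assume XY: "X \<in> graph_ball V \<eta>" "Y \<in> graph_ball V \<eta>" and pq: "0 \<le> p" "0 \<le> q" "p + q = 1"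
  have "norm ((p *\<^sub>R X + q *\<^sub>R Y) *v u) \<le> \<eta> * norm u" for u
  proof -
    have "norm ((p *\<^sub>R X + q *\<^sub>R Y) *v u) \<le> p * norm (X *v u) + q * norm (Y *v u)"
      using norm_triangle_ineq[of "p *\<^sub>R (X *v u)" "q *\<^sub>R (Y *v u)"] pq
      by (simp add: matrix_vector_mult_add_rdistrib scaleR_mult_vec)
    also have "\<dots> \<le> p * (\<eta> * norm u) + q * (\<eta> * norm u)"
      using XY pq by (intro add_mono mult_left_mono) (auto simp: graph_ball_def)
    also have "\<dots> = \<eta> * norm u" using pq by (metis distrib_right mult_1)
    finally show ?thesis .
  qed
  with XY show "p *\<^sub>R X + q *\<^sub>R Y \<in> graph_ball V \<eta>"
    by (simp add: graph_ball_def matrix_add_ldistrib matrix_mult_scaleR)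
qed

lemma graph_ball_frame:
  fixes V :: "complex^'k^'n"
  assumes V: "V \<in> stiefel" and \<eta>: "\<eta> \<ge> 0" and Z: "Z \<in> graph_ball V \<eta>"
    and W: "W \<in> stiefel" "W = (V + Z) ** T"
  shows "W \<in> stiefel_nbhd (\<eta> / sqrt (1 + \<eta>\<^sup>2)) V"
    and "mat_norm2 (proj W - proj V) \<le> \<eta> / sqrt (1 + \<eta>\<^sup>2)"
proof -
  have VZ: "ctranspose V ** Z = 0" and Zs: "\<forall>u. norm (Z *v u) \<le> \<eta> * norm u"
    using Z by (auto simp: graph_ball_def)
  note frame = graph_frame(3,4)[OF V VZ W Zs]
  show "W \<in> stiefel_nbhd (\<eta> / sqrt (1 + \<eta>\<^sup>2)) V"
    by (rule stiefel_nbhd_I[OF W(1) V \<eta> frame(2)])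
  show "mat_norm2 (proj W - proj V) \<le> \<eta> / sqrt (1 + \<eta>\<^sup>2)"
  proof (rule mat_norm2_leI)
    fix x
    have N: "1 + \<eta>\<^sup>2 > 0" by (simp add: add_pos_nonneg)
    have "(1 + \<eta>\<^sup>2) * (norm ((proj W - proj V) *v x))\<^sup>2 \<le> \<eta>\<^sup>2 * (norm x)\<^sup>2"
      by (rule proj_distance[OF V W(1) frame])
    then have "(norm ((proj W - proj V) *v x))\<^sup>2 \<le> \<eta>\<^sup>2 * (norm x)\<^sup>2 / (1 + \<eta>\<^sup>2)"
      using N by (simp add: pos_le_divide_eq mult.commute)
    also have "\<dots> = (\<eta> / sqrt (1 + \<eta>\<^sup>2) * norm x)\<^sup>2"
      using N by (simp add: power_mult_distrib power_divide)
    finally show "norm ((proj W - proj V) *v x) \<le> \<eta> / sqrt (1 + \<eta>\<^sup>2) * norm x"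
      by (rule power2_le_imp_le) (use \<eta> in simp)
  qed
qed

text \<open>The Brouwer argument, separated from the suprema. The hypothesis \<open>near\<close> may
  use both forms of closeness: the angle bound places the projection where the suprema apply, and
  the bound on the difference of projections is what a Lipschitz constant multiplies.\<close>

lemma perturbed_solution_exists:
  fixes V :: "complex^'k^'n" and H :: "complex^'n^'n"
  assumes kn: "CARD('k) < CARD('n)" and H: "hermitian H" and V: "splits H V a b" and ab: "a < b"
    and B_herm: "\<And>P. P \<in> proj ` (stiefel :: (complex^'k^'n) set) \<Longrightarrow> hermitian (B P)"
    and B_cont: "continuous_on (proj ` (stiefel :: (complex^'k^'n) set)) B"
    and \<eta>: "0 \<le> \<eta>" "\<eta> < 1" and \<epsilon>: "\<epsilon> * (1 + \<eta>\<^sup>2) \<le> \<eta> * (b - a)"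
    and near: "\<And>W :: complex^'k^'n. W \<in> stiefel_nbhd (\<eta> / sqrt (1 + \<eta>\<^sup>2)) V \<Longrightarrow>
      mat_norm2 (proj W - proj V) \<le> \<eta> / sqrt (1 + \<eta>\<^sup>2) \<Longrightarrow> mat_norm2 (B (proj W) - H) \<le> \<epsilon>"
  shows "\<exists>W :: complex^'k^'n. nepv_solution B W \<and> W \<in> stiefel_nbhd (\<eta> / sqrt (1 + \<eta>\<^sup>2)) V"
proof -
  have VS: "V \<in> stiefel" by (rule splitsD(1)[OF V])
  have N: "1 + \<eta>\<^sup>2 > 0" by (simp add: add_pos_nonneg)
  \<comment> \<open>From \<open>2 * \<eta> < 1 + \<eta>\<^sup>2\<close>, strict because
    \<open>\<eta> < 1\<close>.\<close>
  have eps: "2 * \<epsilon> < b - a"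
  proof -
    have "0 < (1 - \<eta>)\<^sup>2" using \<eta> by simp
    then have "2 * \<eta> < 1 + \<eta>\<^sup>2" by (simp add: power2_diff)
    then have "2 * \<eta> * (b - a) < (1 + \<eta>\<^sup>2) * (b - a)" using ab by simp
    with \<epsilon> have "(1 + \<eta>\<^sup>2) * (2 * \<epsilon>) < (1 + \<eta>\<^sup>2) * (b - a)" by (simp add: algebra_simps)
    then show ?thesis using N by (simp only: mult_less_cancel_left_pos)
  qed
  let ?D = "{H :: complex^'n^'n. hermitian H \<and> eigval CARD('k) H < eigval (CARD('k) + 1) H}"
  define \<Phi> where "\<Phi> Z = (low_frame (B (graph_proj V Z)) :: complex^'k^'n)" for Z
  \<comment> \<open>The self-map is expressed in graph coordinates. It sees the arbitrarily chosen
    frame \<open>\<Phi> Z\<close> only through its projection, so it can be continuous.\<close>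
  define F where "F Z = graph_of V (proj (\<Phi> Z))" for Z
  have frame: "\<exists>W (T :: complex^'k^'k). W \<in> stiefel \<and> W = (V + Z) ** T" if "Z \<in> graph_ball V \<eta>" for Z
    using graph_frame_exists[OF VS, of Z] that by (auto simp: graph_ball_def)
  have in_proj: "graph_proj V Z \<in> proj ` (stiefel :: (complex^'k^'n) set)"
    and det_G: "det (mat 1 + ctranspose Z ** Z) \<noteq> 0"
    and in_D: "B (graph_proj V Z) \<in> ?D"
    and image: "\<exists>T. \<Phi> Z = (V + F Z) ** T" "F Z \<in> graph_ball V \<eta>"
    and det_Q: "det (ctranspose V ** proj (\<Phi> Z) ** V) \<noteq> 0"
    if Z: "Z \<in> graph_ball V \<eta>" for Z
  proof -
    have VZ: "ctranspose V ** Z = 0" using Z by (simp add: graph_ball_def)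
    obtain W and T :: "complex^'k^'k" where W: "W \<in> stiefel" "W = (V + Z) ** T" using frame[OF Z] by blast
    have projW: "proj W = graph_proj V Z" and "det (mat 1 + ctranspose Z ** Z) \<noteq> 0"
      by (rule proj_graph_frame[OF VS VZ W])+
    then show "det (mat 1 + ctranspose Z ** Z) \<noteq> 0" by blast
    show ip: "graph_proj V Z \<in> proj ` (stiefel :: (complex^'k^'n) set)"
      using W(1) projW by (metis imageI)
    define H' where "H' = B (graph_proj V Z)"
    have H': "hermitian H'" unfolding H'_def by (rule B_herm[OF ip])
    have "mat_norm2 (H' - H) \<le> \<epsilon>"
      using near[OF graph_ball_frame[OF VS \<eta>(1) Z W]] by (simp add: H'_def projW)
    then have op: "\<forall>x. norm ((H' - H) *v x) \<le> \<epsilon> * norm x"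
      using norm_mult_vec_le mult_right_mono norm_ge_zero order_trans by metis
    have lo: "eigval CARD('k) H' \<le> a + \<epsilon>"
      by (rule splits_eigval_le[OF H' V less_imp_le[OF kn] op])
    have hi: "b - \<epsilon> \<le> eigval (CARD('k) + 1) H'"
      by (rule splits_eigval_ge[OF H' V kn op])
    have gap: "eigval CARD('k) H' < eigval (CARD('k) + 1) H'" "eigval CARD('k) H' < b - \<epsilon>"
      using lo hi eps by linarith+
    then show "B (graph_proj V Z) \<in> ?D" using H' by (simp add: H'_def)
    have split': "splits H' (\<Phi> Z) (eigval CARD('k) H') (eigval (CARD('k) + 1) H')"
      unfolding \<Phi>_def H'_def[symmetric] by (rule low_frame(1)[OF H' kn])
    obtain Z' T' s where Z': "\<Phi> Z = (V + Z') ** T'" "ctranspose V ** Z' = 0"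
      "\<forall>u. norm (Z' *v u) \<le> s * norm u" and s: "0 \<le> s" "s < 1" "s * (b - a) \<le> \<epsilon> * (1 + s\<^sup>2)"
      by (rule splits_perturbation[OF H H' V split' op eps gap])
    \<comment> \<open>Both numbers lie in [0, 1), where t / (1 + t^2) is strictly increasing; its
      value at \<open>s\<close> is at most the one at \<open>\<eta>\<close>. The factorization below
      is this monotonicity after clearing denominators.\<close>
    have "s \<le> \<eta>"
    proof (rule ccontr)
      assume "\<not> s \<le> \<eta>"
      have "(s * (b - a)) * (1 + \<eta>\<^sup>2) \<le> (\<epsilon> * (1 + s\<^sup>2)) * (1 + \<eta>\<^sup>2)"
        using s(3) N by (intro mult_right_mono) auto
      also have "\<dots> = (\<epsilon> * (1 + \<eta>\<^sup>2)) * (1 + s\<^sup>2)" by simp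
      also have "\<dots> \<le> (\<eta> * (b - a)) * (1 + s\<^sup>2)"
        using \<epsilon> by (intro mult_right_mono) auto
      finally have "(b - a) * ((s - \<eta>) * (1 - s * \<eta>)) \<le> 0"
        by (simp add: algebra_simps power2_eq_square)
      moreover have "s * \<eta> < 1" using s \<eta> mult_strict_mono'[of s 1 \<eta> 1] by simp
      then have "0 < (b - a) * ((s - \<eta>) * (1 - s * \<eta>))"
        using ab \<open>\<not> s \<le> \<eta>\<close> by (intro mult_pos_pos) auto
      ultimately show False by linarith
    qed
    then have "norm (Z' *v u) \<le> \<eta> * norm u" for u
      using Z'(3) mult_right_mono norm_ge_zero order_trans by metis
    then have ball: "Z' \<in> graph_ball V \<eta>" using Z'(2) by (simp add: graph_ball_def)
    have FZ: "F Z = Z'" and "det (ctranspose V ** proj (\<Phi> Z) ** V) \<noteq> 0"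
      unfolding F_def by (rule proj_graph_frame(3,4)[OF VS Z'(2) splitsD(1)[OF split'] Z'(1)])+
    then show "\<exists>T. \<Phi> Z = (V + F Z) ** T" "F Z \<in> graph_ball V \<eta>"
      "det (ctranspose V ** proj (\<Phi> Z) ** V) \<noteq> 0"
      using Z'(1) ball by auto
  qed
  have "continuous_on (graph_ball V \<eta>) (graph_proj V)"
    unfolding graph_proj_def
    by (intro continuous_intros continuous_on_matrix_inv det_G)
  then have "continuous_on (graph_ball V \<eta>) (\<lambda>Z. B (graph_proj V Z))"
    by (rule continuous_on_compose2[OF B_cont]) (use in_proj in blast)
  then have "continuous_on (graph_ball V \<eta>) (\<lambda>Z. proj (\<Phi> Z))"
    unfolding \<Phi>_def by (rule continuous_on_compose2[OF continuous_on_low_proj[OF kn]]) (use in_D in blast)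
  then have "continuous_on (graph_ball V \<eta>) F"
    unfolding F_def graph_of_def by (intro continuous_intros continuous_on_matrix_inv det_Q)
  moreover have "0 \<in> graph_ball V \<eta>" using \<eta> by (simp add: graph_ball_def)
  ultimately obtain Z where Z: "Z \<in> graph_ball V \<eta>" "F Z = Z"
    using brouwer[OF graph_ball_compact graph_ball_convex, of V \<eta> F] image(2) by blast
  define W where "W = \<Phi> Z"
  obtain T where T: "W = (V + Z) ** T" using image(1)[OF Z(1)] Z(2) by (auto simp: W_def)
  have H': "hermitian (B (graph_proj V Z))" by (rule B_herm[OF in_proj[OF Z(1)]])
  have split: "splits (B (graph_proj V Z)) W (eigval CARD('k) (B (graph_proj V Z)))
      (eigval (CARD('k) + 1) (B (graph_proj V Z)))"
    unfolding W_def \<Phi>_def by (rule low_frame(1)[OF H' kn])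
  have eig: "\<forall>j\<in>{1..CARD('k)}. eigval j (ctranspose W ** B (graph_proj V Z) ** W)
      = eigval j (B (graph_proj V Z))"
    unfolding W_def \<Phi>_def by (rule low_frame(2)[OF H' kn])
  have WS: "W \<in> stiefel" by (rule splitsD(1)[OF split])
  have VZ: "ctranspose V ** Z = 0" using Z(1) by (simp add: graph_ball_def)
  \<comment> \<open>The fixed point closes the loop: \<open>W\<close> spans the lower eigenspace of
    \<open>B\<close> at \<open>graph_proj V Z\<close>, and that point is the projection of
    \<open>W\<close> itself.\<close>
  have projW: "proj W = graph_proj V Z" by (rule proj_graph_frame(1)[OF VS VZ WS T])
  have "B (graph_proj V Z) ** W = W ** (ctranspose W ** B (graph_proj V Z) ** W)"
    using split unfolding splits_def by blast
  with WS eig have "nepv_solution B W" unfolding nepv_solution_def projW Let_def by blast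
  moreover have "W \<in> stiefel_nbhd (\<eta> / sqrt (1 + \<eta>\<^sup>2)) V"
    by (rule graph_ball_frame(1)[OF VS \<eta>(1) Z(1) WS T])
  ultimately show ?thesis by blast
qed

text \<open>As k < n, some nonzero vector is orthogonal to the range of \<open>V\<close>; using it
  for all columns gives a nonzero graph coordinate, scaled to operator norm \<open>\<eta>\<close>.
  Different graph coordinates give different projections.\<close>

lemma stiefel_nbhd_nontrivial:
  fixes V :: "complex^'k^'n"
  assumes kn: "CARD('k) < CARD('n)" and V: "V \<in> stiefel" and \<eta>: "\<eta> > 0"
  shows "\<exists>W \<in> stiefel_nbhd (\<eta> / sqrt (1 + \<eta>\<^sup>2)) V. proj W \<noteq> proj V"
proof -
  from underdetermined_system[OF _ _ kn, of "\<lambda>i j. ctranspose V $ i $ j"]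
  obtain c where c: "\<exists>j. c j \<noteq> 0" "\<forall>i. (\<Sum>j\<in>UNIV. ctranspose V $ i $ j * c j) = 0" by auto
  define x where "x = (\<chi> j. c j)"
  define Z0 :: "complex^'k^'n" where "Z0 = cols (\<lambda>_. x)"
  have Vx: "ctranspose V *v x = 0" using c(2) by (simp add: x_def vec_eq_iff matrix_vector_mult_def)
  have "x \<noteq> 0" using c(1) by (auto simp: x_def vec_eq_iff)
  then have Z0: "Z0 \<noteq> 0" by (simp add: Z0_def cols_def vec_eq_iff)
  have VZ0: "ctranspose V ** Z0 = 0"
    unfolding Z0_def mult_cols Vx by (simp add: cols_def vec_eq_iff)
  define r where "r = \<eta> / mat_norm2 Z0"
  have r: "r > 0" using \<eta> mat_norm2_pos[OF Z0] by (simp add: r_def)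
  define Z where "Z = r *\<^sub>R Z0"
  have VZ: "ctranspose V ** Z = 0" by (simp add: Z_def matrix_mult_scaleR VZ0)
  have "norm (Z *v u) \<le> \<eta> * norm u" for u
  proof -
    have "r * norm (Z0 *v u) \<le> r * (mat_norm2 Z0 * norm u)"
      using r by (intro mult_left_mono norm_mult_vec_le) simp
    then show ?thesis using r \<eta> mat_norm2_pos[OF Z0] by (simp add: Z_def scaleR_mult_vec r_def)
  qed
  with VZ have Z: "Z \<in> graph_ball V \<eta>" by (simp add: graph_ball_def)
  obtain T :: "complex^'k^'k" where T: "(V + Z) ** T \<in> stiefel" using graph_frame_exists[OF V VZ] by blast
  have "graph_of V (proj ((V + Z) ** T)) = Z" by (rule proj_graph_frame(3)[OF V VZ T refl])
  \<comment> \<open>\<open>V\<close> is itself the graph of the zero matrix.\<close>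
  moreover have "graph_of V (proj V) = 0" by (rule proj_graph_frame(3)[OF V _ V, of 0 "mat 1"]) simp_all
  moreover have "Z \<noteq> 0" using Z0 r by (simp add: Z_def)
  ultimately have "proj ((V + Z) ** T) \<noteq> proj V" by auto
  with graph_ball_frame(1)[OF V less_imp_le[OF \<eta>] Z T refl] show ?thesis by blast
qed

text \<open>A linear map in finite dimension is Lipschitz, so the supremum \<open>d\<^sub>1\<close>
  is finite without a separate assumption. Norm equivalence converts the Frobenius constant to the
  operator norm.\<close>

lemma lip_values_linear_bdd:
  fixes B :: "complex^'n^'n \<Rightarrow> complex^'n^'n"
  assumes "linear B"
  shows "bdd_above (lip_values B \<xi> (V :: complex^'k^'n))"
proof -
  obtain K where K: "\<And>X. norm (B X) \<le> norm X * K" "K > 0"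
    using bounded_linear.pos_bounded[of B] assms by (auto simp: linear_conv_bounded_linear)
  define C where "C = real (CARD('n) * CARD('n)) * K"
  show ?thesis
  proof (rule bdd_aboveI)
    fix v assume "v \<in> lip_values B \<xi> V"
    then obtain P where P: "P \<noteq> proj V" "v = mat_norm2 (B P - B (proj V)) / mat_norm2 (P - proj V)"
      by (auto simp: lip_values_def)
    have pos: "mat_norm2 (P - proj V) > 0" using P(1) by (intro mat_norm2_pos) simp
    have "mat_norm2 (B P - B (proj V)) \<le> norm (B (P - proj V))"
      using linear_diff[OF assms] by (metis mat_norm2_leI norm_mult_vec_le_norm)
    also have "\<dots> \<le> norm (P - proj V) * K" by (rule K)
    also have "\<dots> \<le> (real (CARD('n) * CARD('n)) * mat_norm2 (P - proj V)) * K"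
      using K(2) by (intro mult_right_mono norm_le_operator_bound norm_mult_vec_le) auto
    finally show "v \<le> C" using pos by (simp add: P(2) C_def pos_divide_le_eq ac_simps)
  qed
qed

text \<open>Away from \<open>proj V\<close> this is the defining property of the supremum; at
  \<open>proj V\<close>, which the quotients leave out, both sides vanish.\<close>

lemma lip_values_Sup:
  fixes B :: "complex^'n^'n \<Rightarrow> complex^'n^'n" and V :: "complex^'k^'n"
  assumes bdd: "bdd_above (lip_values B \<xi> V)" and P: "P \<in> proj_nbhd \<xi> V"
  shows "mat_norm2 (B P - B (proj V)) \<le> Sup (lip_values B \<xi> V) * mat_norm2 (P - proj V)"
proof (cases "P = proj V")
  case True
  have "mat_norm2 (0 :: complex^'n^'n) \<le> 0" by (rule mat_norm2_leI) simp
  then show ?thesis using mat_norm2_nonneg[of "0 :: complex^'n^'n"] by (simp add: True)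
next
  case False
  then have "mat_norm2 (B P - B (proj V)) / mat_norm2 (P - proj V) \<in> lip_values B \<xi> V"
    using P by (auto simp: lip_values_def)
  then have "mat_norm2 (B P - B (proj V)) / mat_norm2 (P - proj V) \<le> Sup (lip_values B \<xi> V)"
    by (rule cSup_upper[OF _ bdd])
  moreover have "mat_norm2 (P - proj V) > 0" using False by (intro mat_norm2_pos) simp
  ultimately show ?thesis by (simp add: pos_divide_le_eq)
qed

lemma lip_values_Sup_nonneg:
  fixes B :: "complex^'n^'n \<Rightarrow> complex^'n^'n" and V :: "complex^'k^'n"
  assumes bdd: "bdd_above (lip_values B \<xi> V)" and P: "P \<in> proj_nbhd \<xi> V" "P \<noteq> proj V"
  shows "Sup (lip_values B \<xi> V) \<ge> 0"
proof -
  have "0 \<le> Sup (lip_values B \<xi> V) * mat_norm2 (P - proj V)"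
    using lip_values_Sup[OF bdd P(1)] mat_norm2_nonneg order_trans by blast
  moreover have "mat_norm2 (P - proj V) > 0" using P by (intro mat_norm2_pos) simp
  ultimately show ?thesis by (simp add: zero_le_mult_iff)
qed

theorem theorem2p3:
  fixes A0 A0' :: "complex^'n^'n"
    and A1 A2 A1' A2' A A' :: "complex^'n^'n \<Rightarrow> complex^'n^'n"
    and Vs :: "complex^'k^'n"
    and g h \<zeta> \<xi> \<delta> d \<eta>s \<tau>s :: real
  assumes dims: "2 * CARD('k) \<le> CARD('n)"
    and A_eq: "\<And>P. A P = A0 + A1 P + A2 P"
    and A0_herm: "hermitian A0"
    and A1_lin: "linear A1"
    and A1_herm: "\<And>P. P \<in> proj ` (stiefel :: (complex^'k^'n) set) \<Longrightarrow> hermitian (A1 P)"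
    and A2_herm: "\<And>P. P \<in> proj ` (stiefel :: (complex^'k^'n) set) \<Longrightarrow> hermitian (A2 P)"
    and A_cont: "continuous_on (proj ` (stiefel :: (complex^'k^'n) set)) A"
    and A'_eq: "\<And>P. A' P = A0' + A1' P + A2' P"
    and A0'_herm: "hermitian A0'"
    and A1'_herm: "\<And>P. P \<in> proj ` (stiefel :: (complex^'k^'n) set) \<Longrightarrow> hermitian (A1' P)"
    and A2'_herm: "\<And>P. P \<in> proj ` (stiefel :: (complex^'k^'n) set) \<Longrightarrow> hermitian (A2' P)"
    and A'_cont: "continuous_on (proj ` (stiefel :: (complex^'k^'n) set)) A'"
    and sol: "nepv_solution A Vs"
    and g_eq: "g = eigval (CARD('k) + 1) (A (proj Vs)) - eigval CARD('k) (A (proj Vs))"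
    and g_pos: "g > 0"
    and h_eq: "h = Max ((\<lambda>j. eigval (CARD('k) + j) (A (proj Vs)) - eigval j (A (proj Vs)))
                         ` {1..CARD('k)})"
    and \<zeta>_eq: "\<zeta> = sqrt g / (sqrt g + sqrt (2 * h))"
    and \<xi>_pos: "\<xi> > 0"
    and \<delta>1_fin: "bdd_above (pert_values A1 A1' \<xi> Vs)"
    and \<delta>2_fin: "bdd_above (pert_values A2 A2' \<xi> Vs)"
    and d2_fin: "bdd_above (lip_values A2 \<xi> Vs)"
    and \<delta>_eq: "\<delta> = mat_norm2 (A0' - A0) + Sup (pert_values A1 A1' \<xi> Vs)
                      + Sup (pert_values A2 A2' \<xi> Vs)"
    and d_eq: "d = Sup (lip_values A1 \<xi> Vs) + Sup (lip_values A2 \<xi> Vs)"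
    and \<eta>s_root: "smallest_positive_root (eta_fun g d \<delta>) \<eta>s"
    and \<eta>s_less: "\<eta>s < \<zeta>"
    and \<tau>s_eq: "\<tau>s = \<eta>s / sqrt (1 + \<eta>s\<^sup>2)"
    and \<tau>s_le: "\<tau>s \<le> \<xi>"
  shows "\<exists>Vt :: complex^'k^'n. nepv_solution A' Vt \<and> Vt \<in> stiefel_nbhd \<tau>s Vs"
proof -
  have kn: "CARD('k) < CARD('n)" using dims zero_less_card_finite[where 'a = 'k] by linarith
  define H where "H = A (proj Vs)"
  have Vs: "Vs \<in> stiefel" and HV: "H ** Vs = Vs ** (ctranspose Vs ** H ** Vs)"
    and eig: "\<forall>j\<in>{1..CARD('k)}. eigval j (ctranspose Vs ** H ** Vs) = eigval j H"
    using sol unfolding nepv_solution_def Let_def H_def by blast+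
  have H: "hermitian H"
    unfolding H_def A_eq using Vs by (intro hermitian_add A0_herm A1_herm A2_herm imageI)
  have A'_herm: "hermitian (A' P)" if "P \<in> proj ` (stiefel :: (complex^'k^'n) set)" for P
    unfolding A'_eq using that by (intro hermitian_add A0'_herm A1'_herm A2'_herm)
  define a where "a = eigval CARD('k) H"
  define b where "b = eigval (CARD('k) + 1) H"
  have g: "g = b - a" by (simp add: g_eq a_def b_def H_def)
  have split: "splits H Vs a b"
    unfolding a_def b_def using eig g g_pos
    by (intro solution_splits[OF H kn Vs HV]) (simp_all add: a_def b_def)
  have \<eta>_pos: "\<eta>s > 0" and root: "g * \<eta>s = d * \<eta>s * sqrt (1 + \<eta>s\<^sup>2) + (1 + \<eta>s\<^sup>2) * \<delta>"
    using \<eta>s_root by (auto simp: smallest_positive_root_def eta_fun_def)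
  \<comment> \<open>The term j = 1 of the maximum is at least \<open>g\<close>, because the smallest
    eigenvalue is at most the k-th. Positivity of \<open>h\<close> makes \<open>\<zeta>\<close>, and
    with it \<open>\<eta>s\<close>, smaller than 1.\<close>
  have "h > 0"
  proof -
    have "eigval (CARD('k) + 1) H - eigval 1 H \<le> h"
      unfolding h_eq H_def by (rule Max_ge) (auto intro: image_eqI[of _ _ 1])
    moreover have "eigval 1 H \<le> a" unfolding a_def using kn by (intro eigval_mono[OF H]) auto
    ultimately show ?thesis using g g_pos by (simp add: b_def)
  qed
  then have "\<zeta> < 1" using g_pos by (simp add: \<zeta>_eq add_pos_pos)
  then have \<eta>_less: "\<eta>s < 1" using \<eta>s_less by simp
  define S where "S = sqrt (1 + \<eta>s\<^sup>2)"
  have S: "S > 0" "S\<^sup>2 = 1 + \<eta>s\<^sup>2" by (simp_all add: S_def add_pos_nonneg)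
  have nbhd: "stiefel_nbhd \<tau>s Vs \<subseteq> stiefel_nbhd \<xi> Vs" using \<tau>s_le by (auto simp: stiefel_nbhd_def)
  have d1_fin: "bdd_above (lip_values A1 \<xi> Vs)" by (rule lip_values_linear_bdd[OF A1_lin])
  \<comment> \<open>\<open>d \<ge> 0\<close> needs a point other than \<open>P\<^sub>*\<close> in the neighbourhood, as the supremum of an empty set of reals is unspecified\<close>
  obtain W0 where W0: "W0 \<in> stiefel_nbhd \<tau>s Vs" "proj W0 \<noteq> proj Vs"
    using stiefel_nbhd_nontrivial[OF kn Vs \<eta>_pos] unfolding \<tau>s_eq by blast
  then have "proj W0 \<in> proj_nbhd \<xi> Vs" using nbhd by (auto simp: proj_nbhd_def)
  then have d: "d \<ge> 0"
    unfolding d_eq using W0(2)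
    by (intro add_nonneg_nonneg lip_values_Sup_nonneg[where P = "proj W0"] d1_fin d2_fin)
  have near: "mat_norm2 (A' (proj W) - H) \<le> \<delta> + d * \<tau>s"
    if W: "W \<in> stiefel_nbhd \<tau>s Vs" "mat_norm2 (proj W - proj Vs) \<le> \<tau>s" for W
  proof -
    define P where "P = proj W"
    have P: "P \<in> proj_nbhd \<xi> Vs" using W nbhd by (auto simp: P_def proj_nbhd_def)
    \<comment> \<open>Three perturbation terms at \<open>P\<close>, bounded by
      \<open>\<delta>\<close>, and two variations of the original map from \<open>proj Vs\<close> to
      \<open>P\<close>, bounded through \<open>d\<close>.\<close>
    have "A' P - H = (A0' - A0) + (A1' P - A1 P) + (A2' P - A2 P)
        + (A1 P - A1 (proj Vs)) + (A2 P - A2 (proj Vs))"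
      by (simp add: H_def A_eq A'_eq)
    then have "mat_norm2 (A' P - H) \<le> mat_norm2 (A0' - A0) + mat_norm2 (A1' P - A1 P)
        + mat_norm2 (A2' P - A2 P) + mat_norm2 (A1 P - A1 (proj Vs)) + mat_norm2 (A2 P - A2 (proj Vs))"
      by (simp only:) (intro order_trans[OF mat_norm2_triangle] add_right_mono order_refl)
    moreover have "mat_norm2 (A1' P - A1 P) \<le> Sup (pert_values A1 A1' \<xi> Vs)"
      using P by (intro cSup_upper \<delta>1_fin) (auto simp: pert_values_def)
    moreover have "mat_norm2 (A2' P - A2 P) \<le> Sup (pert_values A2 A2' \<xi> Vs)"
      using P by (intro cSup_upper \<delta>2_fin) (auto simp: pert_values_def)
    moreover have "mat_norm2 (A1 P - A1 (proj Vs)) + mat_norm2 (A2 P - A2 (proj Vs))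
        \<le> d * mat_norm2 (P - proj Vs)"
      unfolding d_eq distrib_right by (intro add_mono lip_values_Sup d1_fin d2_fin P)
    moreover have "d * mat_norm2 (P - proj Vs) \<le> d * \<tau>s"
      using W(2) d by (intro mult_left_mono) (simp_all add: P_def)
    ultimately show ?thesis by (simp add: \<delta>_eq P_def)
  qed
  \<comment> \<open>The root equation rewritten: the radius \<open>\<delta> + d * \<tau>s\<close>
    satisfies the smallness condition of the fixed point lemma with equality.\<close>
  have "(\<delta> + d * \<tau>s) * (1 + \<eta>s\<^sup>2) = \<eta>s * (b - a)"
  proof -
    have "\<tau>s * (1 + \<eta>s\<^sup>2) = \<eta>s * S"
      using S(1) unfolding \<tau>s_eq S_def[symmetric] S(2)[symmetric] by (simp add: power2_eq_square)
    then have "(\<delta> + d * \<tau>s) * (1 + \<eta>s\<^sup>2) = \<delta> * (1 + \<eta>s\<^sup>2) + d * (\<eta>s * S)"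
      by (simp add: distrib_right mult.assoc)
    then show ?thesis using root by (simp add: g S_def algebra_simps)
  qed
  then show ?thesis
    unfolding \<tau>s_eq using g g_pos \<eta>_pos \<eta>_less near[unfolded \<tau>s_eq]
    by (intro perturbed_solution_exists[OF kn H split _ A'_herm A'_cont,
          where \<epsilon> = "\<delta> + d * (\<eta>s / sqrt (1 + \<eta>s\<^sup>2))"]) auto
qed

end
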